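(* For any $0\leq\gamma<1$ there are $B>0$, $\mu>0$ and $\omega_1=\omega_2>0$ such that for $V(x)=\omega_1^2x_1^2+\omega_2^2x_2^2-\mu$, $x=(x_1,x_2)\in\mathbb{R}^2$, one has $$ \operatorname{Tr}\left( H_B + V \right)_-^\gamma > \frac{B}{2\pi} \sum_{m=0}^\infty \int_{\mathbb{R}^2} \left((2m+1)B + V(x) \right)_-^\gamma \,dx , $$ where $H_B$ is the Landau Hamiltonian in $L^2(\mathbb{R}^2)$.
   Context: For $B>0$ the Landau Hamiltonian in $L^2(\mathbb{R}^2)$ is the self-adjoint operator $$ H_B=\left(-i\frac{\partial}{\partial x_1} + \frac{Bx_2}{2} \right)^2 + \left(-i\frac{\partial}{\partial x_2} - \frac{Bx_1}{2} \right)^2 . $$ $H_B+V$ is the self-adjoint operator in $L^2(\mathbb{R}^2)$ defined in the sense of quadratic forms. For real $a$, $a_-=\max\{-a,0\}$ and $a_-^\gamma=(a_-)^\gamma$; for $\gamma=0$ the convention is $a_-^0=1$ if $a<0$ and $a_-^0=0$ if $a\ge 0$. $\operatorname{Tr}(H_B+V)_-^\gamma$ is the sum of $|E|^\gamma$ over the negative eigenvalues $E$ of $H_B+V$, counted with multiplicity (for $\gamma=0$, the number of negative eigenvalues). *)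

theory Defs
  imports "HOL-Analysis.Analysis"
begin

text \<open>The plane is \<open>real \<times> real\<close> with Lebesgue measure \<open>lborel\<close>. Elements of
  \<open>L\<^sup>2\<close> are represented by functions, and equality in \<open>L\<^sup>2\<close> is equality almost everywhere.\<close>

definition L2 :: "(real \<times> real \<Rightarrow> complex) set" where
  "L2 = {u. u \<in> borel_measurable lborel \<and> integrable lborel (\<lambda>x. (cmod (u x))\<^sup>2)}"

definition L2_inner :: "(real \<times> real \<Rightarrow> complex) \<Rightarrow> (real \<times> real \<Rightarrow> complex) \<Rightarrow> complex" where
  "L2_inner u v = (LINT x|lborel. u x * cnj (v x))"

fun cont_diff :: "nat \<Rightarrow> (real \<times> real \<Rightarrow> complex) \<Rightarrow> bool" where
  "cont_diff 0 f \<longleftrightarrow> continuous_on UNIV f"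
| "cont_diff (Suc k) f \<longleftrightarrow> (\<exists>g h. cont_diff k g \<and> cont_diff k h \<and>
      (\<forall>x. (f has_derivative (\<lambda>d. fst d *\<^sub>R g x + snd d *\<^sub>R h x)) (at x)))"

definition test_functions :: "(real \<times> real \<Rightarrow> complex) set" where
  "test_functions = {\<phi>. (\<forall>k. cont_diff k \<phi>) \<and> compact (closure {x. \<phi> x \<noteq> 0})}"

definition partial1 :: "(real \<times> real \<Rightarrow> complex) \<Rightarrow> real \<times> real \<Rightarrow> complex" where
  "partial1 f x = vector_derivative (\<lambda>t. f (t, snd x)) (at (fst x))"

definition partial2 :: "(real \<times> real \<Rightarrow> complex) \<Rightarrow> real \<times> real \<Rightarrow> complex" where
  "partial2 f x = vector_derivative (\<lambda>t. f (fst x, t)) (at (snd x))"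

definition momentum1 :: "real \<Rightarrow> (real \<times> real \<Rightarrow> complex) \<Rightarrow> real \<times> real \<Rightarrow> complex" where
  "momentum1 B f x = - \<i> * partial1 f x + of_real (B * snd x / 2) * f x"

definition momentum2 :: "real \<Rightarrow> (real \<times> real \<Rightarrow> complex) \<Rightarrow> real \<times> real \<Rightarrow> complex" where
  "momentum2 B f x = - \<i> * partial2 f x - of_real (B * fst x / 2) * f x"

text \<open>\<open>weakly P u p\<close>: \<open>P u = p\<close> in the sense of distributions, for a formally symmetric
  differential operator \<open>P\<close> (so that no adjoint appears on the test function).\<close>

definition weakly :: "((real \<times> real \<Rightarrow> complex) \<Rightarrow> real \<times> real \<Rightarrow> complex) \<Rightarrow>
    (real \<times> real \<Rightarrow> complex) \<Rightarrow> (real \<times> real \<Rightarrow> complex) \<Rightarrow> bool" where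
  "weakly P u p \<longleftrightarrow> (\<forall>\<phi>\<in>test_functions. L2_inner u (P \<phi>) = L2_inner p \<phi>)"

text \<open>The form domain of \<open>H\<^sub>B + V\<close> is the magnetic Sobolev space (the form domain of \<open>H\<^sub>B\<close>)
  intersected with the form domain of \<open>V\<close>. For measurable \<open>V\<close> bounded below the form is
  closed and bounded below on it.\<close>

definition form_domain :: "real \<Rightarrow> (real \<times> real \<Rightarrow> real) \<Rightarrow> (real \<times> real \<Rightarrow> complex) set" where
  "form_domain B V = {u \<in> L2. (\<exists>p\<in>L2. weakly (momentum1 B) u p) \<and>
      (\<exists>p\<in>L2. weakly (momentum2 B) u p) \<and>
      integrable lborel (\<lambda>x. \<bar>V x\<bar> * (cmod (u x))\<^sup>2)}"

text \<open>\<open>form_value B V u v z\<close>: the sesquilinear form of \<open>H\<^sub>B + V\<close> takes the value \<open>z\<close> at \<open>(u, v)\<close>.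
  A relation suffices because distributional momenta are unique up to null sets, so that
  \<open>z\<close> exists and is unique for all \<open>u\<close> and \<open>v\<close> in the form domain.\<close>

definition form_value :: "real \<Rightarrow> (real \<times> real \<Rightarrow> real) \<Rightarrow> (real \<times> real \<Rightarrow> complex) \<Rightarrow>
    (real \<times> real \<Rightarrow> complex) \<Rightarrow> complex \<Rightarrow> bool" where
  "form_value B V u v z \<longleftrightarrow> u \<in> form_domain B V \<and> v \<in> form_domain B V \<and>
    (\<exists>p1\<in>L2. \<exists>p2\<in>L2. \<exists>q1\<in>L2. \<exists>q2\<in>L2.
      weakly (momentum1 B) u p1 \<and> weakly (momentum2 B) u p2 \<and>
      weakly (momentum1 B) v q1 \<and> weakly (momentum2 B) v q2 \<and>
      z = L2_inner p1 q1 + L2_inner p2 q2 + (LINT x|lborel. of_real (V x) * u x * cnj (v x)))"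

text \<open>The graph of the self-adjoint operator associated with the form by the representation
  theorem: \<open>u\<close> is in the operator domain and \<open>(H\<^sub>B + V) u = f\<close>.\<close>

definition landau_op :: "real \<Rightarrow> (real \<times> real \<Rightarrow> real) \<Rightarrow> (real \<times> real \<Rightarrow> complex) \<Rightarrow>
    (real \<times> real \<Rightarrow> complex) \<Rightarrow> bool" where
  "landau_op B V u f \<longleftrightarrow> u \<in> form_domain B V \<and> f \<in> L2 \<and>
    (\<forall>v\<in>form_domain B V. form_value B V u v (L2_inner f v))"

definition eigenspace :: "real \<Rightarrow> (real \<times> real \<Rightarrow> real) \<Rightarrow> real \<Rightarrow> (real \<times> real \<Rightarrow> complex) set" where
  "eigenspace B V E = {u. landau_op B V u (\<lambda>x. of_real E * u x)}"

definition eigenvalues :: "real \<Rightarrow> (real \<times> real \<Rightarrow> real) \<Rightarrow> real set" where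
  "eigenvalues B V = {E. \<exists>u\<in>eigenspace B V E. \<not> (AE x in lborel. u x = 0)}"

definition L2_independent :: "(real \<times> real \<Rightarrow> complex) set \<Rightarrow> bool" where
  "L2_independent S \<longleftrightarrow> (\<forall>c :: (real \<times> real \<Rightarrow> complex) \<Rightarrow> complex.
      (AE x in lborel. (\<Sum>u\<in>S. c u * u x) = 0) \<longrightarrow> (\<forall>u\<in>S. c u = 0))"

definition multiplicity_of :: "real \<Rightarrow> (real \<times> real \<Rightarrow> real) \<Rightarrow> real \<Rightarrow> ennreal" where
  "multiplicity_of B V E =
    (SUP S\<in>{S. finite S \<and> S \<subseteq> eigenspace B V E \<and> L2_independent S}. of_nat (card S))"

text \<open>Since \<open>0 powr 0 = 0\<close>, the exponent \<open>0\<close> follows the convention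
  \<open>a\<^sub>-\<^sup>0 = 1\<close> for \<open>a < 0\<close> and \<open>a\<^sub>-\<^sup>0 = 0\<close> for \<open>a \<ge> 0\<close>.\<close>

definition neg_powr :: "real \<Rightarrow> real \<Rightarrow> real" where
  "neg_powr \<gamma> a = max (- a) 0 powr \<gamma>"

lemma neg_powr_0: "neg_powr 0 a = (if a < 0 then 1 else 0)"
  by (simp add: neg_powr_def)

definition trace_neg :: "real \<Rightarrow> real \<Rightarrow> (real \<times> real \<Rightarrow> real) \<Rightarrow> ennreal" where
  "trace_neg \<gamma> B V =
    (\<Sum>\<^sub>\<infinity>E\<in>{E \<in> eigenvalues B V. E < 0}. multiplicity_of B V E * ennreal (\<bar>E\<bar> powr \<gamma>))"

end

theory Submission imports Defs begin

text \<open>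
  For equal frequencies \<open>\<omega>\<^sub>1 = \<omega>\<^sub>2 = \<omega>\<close> the operator is exactly solvable (Fock and Darwin). With
  \<open>\<Omega>\<^sup>2 = B\<^sup>2 / 4 + \<omega>\<^sup>2\<close> and \<open>z = x\<^sub>1 + \<i> x\<^sub>2\<close>, the functions \<open>z\<^sup>k exp (- \<Omega> \<bar>z\<bar>\<^sup>2 / 2)\<close> are
  eigenfunctions with eigenvalues \<open>2 \<Omega> + k (2 \<Omega> - B) - \<mu>\<close>. These are not all the eigenvalues, but
  the claim is a lower bound on the trace, so exhibiting some of them is enough.

  The phase space side is also explicit. If \<open>B \<le> \<mu> \<le> 3 B\<close>, only the lowest Landau level contributes,
  and its integral is that of a power of a paraboloid:
  the right-hand side is \<open>B / (2 \<omega>\<^sup>2) (\<mu> - B)\<^bsup>\<gamma> + 1\<^esup> / (\<gamma> + 1)\<close>.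

  Take \<open>\<mu> = 3 B\<close>, scale so that the eigenvalue spacing \<open>2 \<Omega> - B\<close> is \<open>1\<close>, and let \<open>2 \<Omega> + B = p + 3 / 2\<close>
  for a natural number \<open>p\<close>. Then \<open>\<mu> - B = p + 1 / 2\<close> and the negative eigenvalues found above are
  \<open>- (j + 1 / 2)\<close> for \<open>j < p\<close>. The sum of \<open>(j + 1 / 2)\<^sup>\<gamma>\<close> is the midpoint rule for the integral
  of the concave function \<open>s\<^sup>\<gamma>\<close>, so it is at least \<open>p\<^bsup>\<gamma> + 1\<^esup> / (\<gamma> + 1)\<close>
  (\<open>powr_le_midpoint_sum\<close>). The right-hand side equals
  \<open>(p + 1 / 2)\<^bsup>\<gamma> + 2\<^esup> / ((p + 3 / 2) (\<gamma> + 1))\<close>, which to first order in \<open>1 / p\<close> is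
  \<open>p\<^bsup>\<gamma> + 1\<^esup> / (\<gamma> + 1)\<close> times \<open>1 - (1 - \<gamma>) / (2 p)\<close>. For \<open>\<gamma> < 1\<close> it is therefore smaller
  once \<open>p\<close> is large (\<open>semiclassical_term_less\<close>).

  The analytic work lies in showing that these classical eigenfunctions are eigenfunctions of the
  operator defined through its form (\<open>landau_op_orbital\<close>). The form domain is described by
  distributional momenta, which can be tested only against smooth functions of compact support.
  A Gaussian times a polynomial is not such a function; multiplying it by a smooth cutoff and
  removing the cutoff by dominated convergence gives the required integration by parts
  (\<open>weakly_magnetic_pairing\<close>).
\<close>

section \<open>Smooth functions\<close>

definition smooth :: "(real \<times> real \<Rightarrow> complex) \<Rightarrow> bool" where
  "smooth f \<longleftrightarrow> (\<forall>k. cont_diff k f)"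

lemma cont_diff_mono: "cont_diff (Suc k) f \<Longrightarrow> cont_diff k f"
proof (induction k arbitrary: f)
  case 0
  then obtain g h where d: "\<And>x. (f has_derivative (\<lambda>d. fst d *\<^sub>R g x + snd d *\<^sub>R h x)) (at x)"
    by auto
  show ?case
    using has_derivative_continuous[OF d] by (simp add: continuous_on_eq_continuous_at)
next
  case (Suc k)
  from Suc.prems obtain g h where "cont_diff (Suc k) g" "cont_diff (Suc k) h"
    "\<forall>x. (f has_derivative (\<lambda>d. fst d *\<^sub>R g x + snd d *\<^sub>R h x)) (at x)"
    using cont_diff.simps(2)[of "Suc k" f] by blast
  thus ?case using Suc.IH cont_diff.simps(2)[of k f] by blast
qed

lemma cont_diff_SucI:
  assumes "cont_diff k g" "cont_diff k h"
    "\<And>x. (f has_derivative (\<lambda>d. fst d *\<^sub>R g x + snd d *\<^sub>R h x)) (at x)"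
  shows "cont_diff (Suc k) f"
  using assms by auto

lemma cont_diff_const: "cont_diff k (\<lambda>_. c)"
proof (induction k arbitrary: c)
  case (Suc k)
  show ?case by (rule cont_diff_SucI[OF Suc[of 0] Suc[of 0]]) (auto intro!: derivative_eq_intros)
qed auto

lemma cont_diff_add: "cont_diff k f \<Longrightarrow> cont_diff k g \<Longrightarrow> cont_diff k (\<lambda>x. f x + g x)"
proof (induction k arbitrary: f g)
  case (Suc k)
  from Suc.prems obtain f1 f2 g1 g2 where
    *: "cont_diff k f1" "cont_diff k f2" "cont_diff k g1" "cont_diff k g2"
    and d: "\<And>x. (f has_derivative (\<lambda>d. fst d *\<^sub>R f1 x + snd d *\<^sub>R f2 x)) (at x)"
      "\<And>x. (g has_derivative (\<lambda>d. fst d *\<^sub>R g1 x + snd d *\<^sub>R g2 x)) (at x)"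
    by auto
  show ?case
    by (rule cont_diff_SucI[OF Suc.IH[OF *(1,3)] Suc.IH[OF *(2,4)]])
       (rule has_derivative_eq_rhs[OF has_derivative_add[OF d]], auto simp: algebra_simps)
qed (auto intro: continuous_intros)

lemma cont_diff_mult: "cont_diff k f \<Longrightarrow> cont_diff k g \<Longrightarrow> cont_diff k (\<lambda>x. f x * g x)"
proof (induction k arbitrary: f g)
  case (Suc k)
  from Suc.prems obtain f1 f2 g1 g2 where
    *: "cont_diff k f1" "cont_diff k f2" "cont_diff k g1" "cont_diff k g2"
    and d: "\<And>x. (f has_derivative (\<lambda>d. fst d *\<^sub>R f1 x + snd d *\<^sub>R f2 x)) (at x)"
      "\<And>x. (g has_derivative (\<lambda>d. fst d *\<^sub>R g1 x + snd d *\<^sub>R g2 x)) (at x)"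
    by auto
  have fg: "cont_diff k f" "cont_diff k g" using Suc.prems cont_diff_mono by blast+
  show ?case
    by (rule cont_diff_SucI[OF cont_diff_add[OF Suc.IH[OF fg(1) *(3)] Suc.IH[OF *(1) fg(2)]]
           cont_diff_add[OF Suc.IH[OF fg(1) *(4)] Suc.IH[OF *(2) fg(2)]]])
       (rule has_derivative_eq_rhs[OF has_derivative_mult[OF d]],
         auto simp: algebra_simps scaleR_conv_of_real)
qed (auto intro: continuous_intros)

lemma cont_diff_fst: "cont_diff k (\<lambda>x. of_real (fst x))"
proof (cases k)
  case (Suc n)
  show ?thesis unfolding Suc
    by (rule cont_diff_SucI[OF cont_diff_const[of n 1] cont_diff_const[of n 0]])
       (auto intro!: derivative_eq_intros simp: scaleR_conv_of_real)
qed (auto intro!: continuous_intros)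

lemma cont_diff_snd: "cont_diff k (\<lambda>x. of_real (snd x))"
proof (cases k)
  case (Suc n)
  show ?thesis unfolding Suc
    by (rule cont_diff_SucI[OF cont_diff_const[of n 0] cont_diff_const[of n 1]])
       (auto intro!: derivative_eq_intros simp: scaleR_conv_of_real)
qed (auto intro!: continuous_intros)

lemma norm_prod_sq: "(norm (x :: real \<times> real))\<^sup>2 = (fst x)\<^sup>2 + (snd x)\<^sup>2"
  by (cases x) (simp add: norm_Pair)

text \<open>Gaussians and cutoffs are both functions of the squared norm, so their derivatives come from one chain rule.\<close>

lemma has_derivative_radial:
  fixes F :: "real \<Rightarrow> real" and F' :: real
  assumes "(F has_real_derivative F') (at (a + b * (norm x)\<^sup>2))"
  shows "((\<lambda>x :: real \<times> real. complex_of_real (F (a + b * (norm x)\<^sup>2))) has_derivative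
     (\<lambda>d. fst d *\<^sub>R (of_real F' * (of_real (2 * b) * of_real (fst x))) +
          snd d *\<^sub>R (of_real F' * (of_real (2 * b) * of_real (snd x))))) (at x)"
proof -
  have q: "((\<lambda>x :: real \<times> real. a + b * (norm x)\<^sup>2) has_derivative
        (\<lambda>d. 2 * b * (fst x * fst d + snd x * snd d))) (at x)"
    unfolding norm_prod_sq by (auto intro!: derivative_eq_intros simp: algebra_simps)
  have "((\<lambda>x :: real \<times> real. F (a + b * (norm x)\<^sup>2)) has_derivative
      (\<lambda>d. F' * (2 * b * (fst x * fst d + snd x * snd d)))) (at x)"
    using has_derivative_compose[OF q, of F "(*) F'"] assms
    by (simp add: has_field_derivative_def)
  from has_derivative_of_real[OF this] show ?thesis
    by (rule has_derivative_eq_rhs) (auto simp: scaleR_conv_of_real algebra_simps)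
qed

text \<open>A whole sequence of functions, each the derivative of the one before, is needed because the induction
  on the order of differentiability moves from \<open>F n\<close> to \<open>F (Suc n)\<close>.\<close>

lemma smooth_radial:
  fixes F :: "nat \<Rightarrow> real \<Rightarrow> real"
  assumes F: "\<And>n t. (F n has_real_derivative F (Suc n) t) (at t)"
  shows "smooth (\<lambda>x. of_real (F n (a + b * (norm x)\<^sup>2)))"
proof -
  have "cont_diff k (\<lambda>x. of_real (F n (a + b * (norm x)\<^sup>2)))" for k n
  proof (induction k arbitrary: n)
    case 0
    have "continuous_on UNIV (F n)"
      using DERIV_isCont[OF F] by (simp add: continuous_on_eq_continuous_at)
    hence "continuous_on UNIV (\<lambda>x :: real \<times> real. F n (a + b * (norm x)\<^sup>2))"
      by (rule continuous_on_compose2) (intro continuous_intros, simp)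
    thus ?case by (simp add: continuous_on_of_real)
  next
    case (Suc k)
    note D = cont_diff_mult[OF Suc.IH[of "Suc n"] cont_diff_mult[OF cont_diff_const]]
    show ?case
      using cont_diff_SucI[OF D[OF cont_diff_fst] D[OF cont_diff_snd] has_derivative_radial[OF F[of n]]] .
  qed
  thus ?thesis by (simp add: smooth_def)
qed

lemma smooth_const: "smooth (\<lambda>_. c)"
  and smooth_fst: "smooth (\<lambda>x. of_real (fst x))"
  and smooth_snd: "smooth (\<lambda>x. of_real (snd x))"
  and smooth_add: "smooth f \<Longrightarrow> smooth g \<Longrightarrow> smooth (\<lambda>x. f x + g x)"
  and smooth_mult: "smooth f \<Longrightarrow> smooth g \<Longrightarrow> smooth (\<lambda>x. f x * g x)"
  by (auto simp: smooth_def simp del: cont_diff.simps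
      intro: cont_diff_const cont_diff_fst cont_diff_snd cont_diff_add cont_diff_mult)

lemma smooth_power: "smooth f \<Longrightarrow> smooth (\<lambda>x. f x ^ n)"
  by (induction n) (auto intro: smooth_const smooth_mult)

lemma smooth_imp_C1:
  assumes "smooth f"
  obtains g h where "continuous_on UNIV g" "continuous_on UNIV h"
    "\<And>x. (f has_derivative (\<lambda>d. fst d *\<^sub>R g x + snd d *\<^sub>R h x)) (at x)"
proof -
  have "cont_diff 1 f" using assms by (auto simp: smooth_def)
  thus ?thesis using that by auto
qed

section \<open>A compactly supported smooth cutoff\<close>

text \<open>The derivatives of \<open>exp (- 1 / t)\<close> on \<open>t > 0\<close> have the form \<open>p (1 / t) exp (- 1 / t)\<close>. In terms of
  \<open>s = 1 / t\<close>, differentiation in \<open>t\<close> maps \<open>p (s) exp (- s)\<close> to \<open>s\<^sup>2 (p (s) - p' (s)) exp (- s)\<close>.\<close>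

fun bump_poly :: "nat \<Rightarrow> real poly" where
  "bump_poly 0 = 1"
| "bump_poly (Suc n) = [:0, 0, 1:] * (bump_poly n - pderiv (bump_poly n))"

definition bump_deriv :: "nat \<Rightarrow> real \<Rightarrow> real" where
  "bump_deriv n t = (if t \<le> 0 then 0 else poly (bump_poly n) (1 / t) * exp (- (1 / t)))"

lemma poly_times_exp_decay: "((\<lambda>s. s ^ k * poly p s * exp (- s)) \<longlongrightarrow> (0::real)) at_top"
proof (induction p arbitrary: k)
  case (pCons a p)
  have "((\<lambda>s. a * (s ^ k / exp s) + s ^ Suc k * poly p s * exp (- s)) \<longlongrightarrow> a * 0 + 0) at_top"
    by (intro tendsto_add tendsto_mult_left tendsto_power_div_exp_0 pCons.IH)
  thus ?case by (simp add: algebra_simps exp_minus field_simps)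
qed simp

text \<open>At \<open>0\<close> the difference quotient from the right is \<open>s p (s) exp (- s)\<close> with \<open>s = 1 / t\<close> tending to
  infinity, so the exponential wins and all one-sided derivatives vanish.\<close>

lemma DERIV_bump_deriv: "(bump_deriv n has_real_derivative bump_deriv (Suc n) t) (at t)"
proof -
  consider "t < 0" | "t = 0" | "t > 0" by linarith
  thus ?thesis
  proof cases
    case 1
    have "((\<lambda>_. 0) has_real_derivative 0) (at t)" by simp
    moreover have "eventually (\<lambda>s. s \<in> {..<0}) (nhds t)"
      using 1 by (intro eventually_nhds_in_open) auto
    hence "eventually (\<lambda>s. bump_deriv n s = 0) (nhds t)"
      by eventually_elim (simp add: bump_deriv_def)
    ultimately show ?thesis using 1
      by (subst DERIV_cong_ev[OF refl]) (auto simp: bump_deriv_def)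
  next
    case 3
    have "((\<lambda>s. poly (bump_poly n) (1 / s) * exp (- (1 / s))) has_real_derivative
        bump_deriv (Suc n) t) (at t)"
      using 3 by (auto intro!: derivative_eq_intros DERIV_chain2[OF poly_DERIV]
          simp: bump_deriv_def field_simps power2_eq_square)
    moreover have "eventually (\<lambda>s. s \<in> {0<..}) (nhds t)"
      using 3 by (intro eventually_nhds_in_open) auto
    hence "eventually (\<lambda>s. bump_deriv n s = poly (bump_poly n) (1 / s) * exp (- (1 / s))) (nhds t)"
      by eventually_elim (simp add: bump_deriv_def)
    ultimately show ?thesis
      by (subst DERIV_cong_ev[OF refl]) auto
  next
    case 2
    have "((\<lambda>h. bump_deriv n h / h) \<longlongrightarrow> 0) (at_left 0)"
      by (rule tendsto_eventually) (auto simp: eventually_at_filter bump_deriv_def)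
    moreover have "((\<lambda>h. bump_deriv n h / h) \<longlongrightarrow> 0) (at_right 0)"
    proof -
      have "((\<lambda>h. inverse h ^ 1 * poly (bump_poly n) (inverse h) * exp (- inverse h)) \<longlongrightarrow> 0) (at_right 0)"
        by (rule filterlim_compose[OF poly_times_exp_decay filterlim_inverse_at_top_right])
      thus ?thesis
        by (rule Lim_transform_eventually)
           (auto simp: eventually_at_filter bump_deriv_def field_simps)
    qed
    ultimately have "((\<lambda>h. bump_deriv n h / h) \<longlongrightarrow> 0) (at 0)"
      by (simp add: filterlim_split_at)
    thus ?thesis using 2 by (simp add: DERIV_def bump_deriv_def)
  qed
qed

lemma bump_0_bounds: "0 \<le> bump_deriv 0 t" "bump_deriv 0 t \<le> 1"
  by (auto simp: bump_deriv_def)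

lemma bump_1_bounds: "\<bar>bump_deriv 1 t\<bar> \<le> 2"
proof (cases "t \<le> 0")
  case False
  define s where "s = 1 / t"
  have s: "s > 0" using False by (simp add: s_def)
  have "s\<^sup>2 / 2 \<le> exp s" using exp_lower_Taylor_quadratic[of s] s by linarith
  hence "s\<^sup>2 * exp (- s) \<le> 2" by (simp add: exp_minus field_simps)
  thus ?thesis using False s by (simp add: bump_deriv_def s_def power2_eq_square pderiv_1)
qed (simp add: bump_deriv_def)

text \<open>The bump is evaluated at \<open>1 - \<bar>x\<bar>\<^sup>2 / (n + 1)\<^sup>2\<close> and normalised so that the value at the origin is \<open>1\<close>.
  It has no plateau; convergence to \<open>1\<close> at every point, with uniform bounds, is what dominated
  convergence uses.\<close>

definition cutoff :: "nat \<Rightarrow> real \<times> real \<Rightarrow> complex" where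
  "cutoff n x = of_real (exp 1) *
     of_real (bump_deriv 0 (1 + (- ((inverse (real (Suc n)))\<^sup>2)) * (norm x)\<^sup>2))"

definition cutoff_slope :: "nat \<Rightarrow> real \<times> real \<Rightarrow> real \<times> real \<Rightarrow> complex" where
  "cutoff_slope n x e = of_real (exp 1 *
     (bump_deriv 1 (1 + (- ((inverse (real (Suc n)))\<^sup>2)) * (norm x)\<^sup>2) *
        (- 2 * (inverse (real (Suc n)))\<^sup>2 * (x \<bullet> e))))"

lemma smooth_cutoff: "smooth (cutoff n)"
  unfolding cutoff_def[abs_def]
  by (intro smooth_mult smooth_const smooth_radial[where F = bump_deriv] DERIV_bump_deriv)

lemma cutoff_has_derivative: "(cutoff n has_derivative cutoff_slope n x) (at x)"
  unfolding cutoff_def[abs_def]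
  by (rule has_derivative_eq_rhs[OF has_derivative_mult[OF has_derivative_const
        has_derivative_radial[OF DERIV_bump_deriv]]])
     (auto simp: fun_eq_iff cutoff_slope_def scaleR_conv_of_real inner_prod_def algebra_simps)

lemma cutoff_outside:
  assumes "norm x > real (Suc n)"
  shows "cutoff n x = 0"
proof -
  have "1 \<le> norm x * inverse (real (Suc n))" using assms by (simp add: field_simps)
  hence "1 \<le> (norm x * inverse (real (Suc n)))\<^sup>2" by (rule one_le_power)
  thus ?thesis by (simp add: cutoff_def bump_deriv_def power_mult_distrib mult.commute)
qed

lemma norm_cutoff_le: "cmod (cutoff n x) \<le> exp 1"
  using bump_0_bounds by (simp add: cutoff_def norm_mult)

lemma norm_cutoff_slope_le:
  "cmod (cutoff_slope n x e) \<le> (inverse (real (Suc n)))\<^sup>2 * (4 * exp 1 * norm e * norm x)"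
proof -
  have "\<bar>bump_deriv 1 t * (- 2 * d * (x \<bullet> e))\<bar> \<le> 2 * (2 * d * (norm x * norm e))" if "d \<ge> 0" for t d
    unfolding abs_mult using that bump_1_bounds[of t] Cauchy_Schwarz_ineq2[of x e]
    by (intro mult_mono) auto
  note * = this
  have "cmod (cutoff_slope n x e) \<le> exp 1 * (2 * (2 * (inverse (real (Suc n)))\<^sup>2 * (norm x * norm e)))"
    unfolding cutoff_slope_def norm_of_real abs_mult[of "exp 1"] abs_exp_cancel
    by (intro mult_left_mono *) auto
  thus ?thesis by (simp add: mult_ac)
qed

lemma inverse_Suc_sq_tendsto: "(\<lambda>n. (inverse (real (Suc n)))\<^sup>2) \<longlonglongrightarrow> 0"
  using tendsto_power[OF LIMSEQ_inverse_real_of_nat, of 2] by simp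

lemma cutoff_tendsto: "(\<lambda>n. cutoff n x) \<longlonglongrightarrow> 1"
proof -
  have "(\<lambda>n. 1 + (- ((inverse (real (Suc n)))\<^sup>2)) * (norm x)\<^sup>2) \<longlonglongrightarrow> 1 + (- 0) * (norm x)\<^sup>2"
    by (intro tendsto_intros inverse_Suc_sq_tendsto)
  hence "(\<lambda>n. bump_deriv 0 (1 + (- ((inverse (real (Suc n)))\<^sup>2)) * (norm x)\<^sup>2)) \<longlonglongrightarrow> bump_deriv 0 1"
    by (intro isCont_tendsto_compose[OF DERIV_isCont[OF DERIV_bump_deriv]]) simp
  hence "(\<lambda>n. cutoff n x) \<longlonglongrightarrow> of_real (exp 1) * of_real (bump_deriv 0 1)"
    unfolding cutoff_def by (intro tendsto_intros)
  moreover have "exp 1 * bump_deriv 0 1 = 1" by (simp add: bump_deriv_def exp_minus)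
  hence "of_real (exp 1) * of_real (bump_deriv 0 1) = (1 :: complex)"
    by (metis of_real_1 of_real_mult)
  ultimately show ?thesis by simp
qed

lemma cutoff_slope_tendsto: "(\<lambda>n. cutoff_slope n x e) \<longlonglongrightarrow> 0"
proof (rule Lim_null_comparison)
  show "(\<lambda>n. (inverse (real (Suc n)))\<^sup>2 * (4 * exp 1 * norm e * norm x)) \<longlonglongrightarrow> 0"
    using tendsto_mult_right[OF inverse_Suc_sq_tendsto, of "4 * exp 1 * norm e * norm x"] by simp
qed (intro always_eventually allI norm_cutoff_slope_le)

section \<open>Radial integrals and Gaussian decay\<close>

text \<open>The disc of squared radius \<open>a\<close> has area \<open>\<pi> a\<close>, so under \<open>x \<mapsto> \<bar>x\<bar>\<^sup>2\<close> planar Lebesgue measure becomes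
  \<open>\<pi>\<close> times Lebesgue measure on the half line. This replaces polar coordinates.\<close>

lemma distr_norm_sq:
  "distr lborel borel (\<lambda>x :: real \<times> real. (norm x)\<^sup>2) = density lborel (\<lambda>s. ennreal pi * indicator {0..} s)"
proof (rule measure_eqI_generator_eq[where E = "range atMost" and \<Omega> = UNIV and A = "\<lambda>i. {..real i}"])
  have D: "emeasure (distr lborel borel (\<lambda>x :: real \<times> real. (norm x)\<^sup>2)) {..a} = ennreal (pi * max a 0)" for a
  proof -
    have "emeasure (distr lborel borel (\<lambda>x :: real \<times> real. (norm x)\<^sup>2)) {..a}
        = emeasure lborel {x :: real \<times> real. (norm x)\<^sup>2 \<le> a}"
      by (subst emeasure_distr) (auto intro!: arg_cong[where f = "emeasure lborel"])
    also have "\<dots> = ennreal (pi * max a 0)"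
    proof (cases "a \<ge> 0")
      case True
      have "{x :: real \<times> real. (norm x)\<^sup>2 \<le> a} = cball 0 (sqrt a)"
        using True by (auto simp: real_le_rsqrt sqrt_ge_absD)
      thus ?thesis using True by (simp add: emeasure_cball unit_ball_vol_2)
    next
      case False
      hence empty: "{x :: real \<times> real. (norm x)\<^sup>2 \<le> a} = {}"
        by (auto simp: not_le intro: less_le_trans[OF _ zero_le_power2])
      show ?thesis unfolding empty using False by (simp add: max_def)
    qed
    finally show ?thesis .
  qed
  have R: "emeasure (density lborel (\<lambda>s. ennreal pi * indicator {0..} s)) {..a} = ennreal (pi * max a 0)" for a
  proof -
    have "emeasure (density lborel (\<lambda>s. ennreal pi * indicator {0..} s)) {..a}
        = (\<integral>\<^sup>+ s. ennreal pi * indicator {0..a} s \<partial>lborel)"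
      by (subst emeasure_density) (auto intro!: nn_integral_cong split: split_indicator)
    also have "\<dots> = ennreal pi * emeasure lborel {0..a}"
      by (simp add: nn_integral_cmult_indicator)
    also have "\<dots> = ennreal (pi * max a 0)"
      by (simp add: emeasure_lborel_Icc_eq ennreal_mult max_def)
    finally show ?thesis .
  qed
  show "emeasure (distr lborel borel (\<lambda>x :: real \<times> real. (norm x)\<^sup>2)) X
      = emeasure (density lborel (\<lambda>s. ennreal pi * indicator {0..} s)) X" if "X \<in> range atMost" for X
    using that D R by auto
  show "emeasure (distr lborel borel (\<lambda>x :: real \<times> real. (norm x)\<^sup>2)) {..real i} \<noteq> \<infinity>" for i
    unfolding D by simp
  show "Int_stable (range (atMost :: real \<Rightarrow> _))"
    by (auto simp: Int_stable_def)
  show "(\<Union>i. {..real i}) = UNIV" by (auto simp: real_arch_simple)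
qed (auto simp: borel_eq_atMost)

lemma nn_integral_radial:
  assumes [measurable]: "f \<in> borel_measurable borel"
  shows "(\<integral>\<^sup>+ x. f ((norm (x :: real \<times> real))\<^sup>2) \<partial>lborel) = ennreal pi * (\<integral>\<^sup>+ s. f s * indicator {0..} s \<partial>lborel)"
proof -
  have "(\<integral>\<^sup>+ x. f ((norm (x :: real \<times> real))\<^sup>2) \<partial>lborel)
      = (\<integral>\<^sup>+ s. f s \<partial>distr lborel borel (\<lambda>x :: real \<times> real. (norm x)\<^sup>2))"
    by (subst nn_integral_distr) auto
  also have "\<dots> = (\<integral>\<^sup>+ s. ennreal pi * (f s * indicator {0..} s) \<partial>lborel)"
    unfolding distr_norm_sq by (subst nn_integral_density) (auto simp: ac_simps)
  finally show ?thesis by (simp add: nn_integral_cmult)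
qed

text \<open>In the variable \<open>s = \<bar>x\<bar>\<^sup>2\<close> the integrand is a power of an affine function; substituting
  \<open>t = l - a s\<close> turns it into \<open>t\<^sup>\<gamma>\<close> on \<open>{0..l}\<close>.\<close>

lemma nn_integral_neg_powr_paraboloid:
  assumes a: "a > 0" and l: "l \<ge> 0" and \<gamma>: "\<gamma> \<ge> 0"
  shows "(\<integral>\<^sup>+ x. ennreal (neg_powr \<gamma> (a * (norm (x :: real \<times> real))\<^sup>2 - l)) \<partial>lborel)
     = ennreal (pi / a * (l powr (\<gamma> + 1) / (\<gamma> + 1)))"
proof -
  have [measurable]: "neg_powr \<gamma> \<in> borel_measurable borel"
    unfolding neg_powr_def[abs_def] by measurable
  have "(\<integral>\<^sup>+ s. ennreal (neg_powr \<gamma> (a * s - l)) * indicator {0..} s \<partial>lborel)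
      = ennreal (1 / a) * (\<integral>\<^sup>+ t. ennreal (neg_powr \<gamma> (a * (l / a + (- 1 / a) * t) - l)) *
            indicator {0..} (l / a + (- 1 / a) * t) \<partial>lborel)"
    using a by (subst nn_integral_real_affine[of _ "- 1 / a" "l / a"]) auto
  also have "(\<integral>\<^sup>+ t. ennreal (neg_powr \<gamma> (a * (l / a + (- 1 / a) * t) - l)) *
            indicator {0..} (l / a + (- 1 / a) * t) \<partial>lborel)
      = (\<integral>\<^sup>+ t. ennreal (t powr \<gamma> * indicator {0..l} t) \<partial>lborel)"
  proof (rule nn_integral_cong)
    fix t
    have "a * (l / a + (- 1 / a) * t) - l = - t" using a by (simp add: field_simps)
    moreover have "(0 \<le> l / a + (- 1 / a) * t) = (t \<le> l)" using a by (simp add: field_simps)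
    ultimately show "ennreal (neg_powr \<gamma> (a * (l / a + (- 1 / a) * t) - l)) *
            indicator {0..} (l / a + (- 1 / a) * t) = ennreal (t powr \<gamma> * indicator {0..l} t)"
      by (auto simp: neg_powr_def indicator_def max_def)
  qed
  also have "\<dots> = ennreal (l powr (\<gamma> + 1) / (\<gamma> + 1))"
    using nn_integral_has_integral_lebesgue[OF _ has_integral_powr_from_0[of \<gamma> l]] \<gamma> l
    by (simp add: mult.commute)
  finally show ?thesis
    using a \<gamma> by (subst nn_integral_radial) (auto simp flip: ennreal_mult)
qed

lemma gaussian_integrable:
  assumes c: "c > 0"
  shows "integrable lborel (\<lambda>x :: real \<times> real. exp (- c * (norm x)\<^sup>2))"
proof (rule integrableI_nonneg)
  have "((\<lambda>s. - exp (- c * s) / c) \<longlongrightarrow> - 0 / c) at_top"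
    by (intro tendsto_intros filterlim_compose[OF exp_at_bot]
        filterlim_tendsto_neg_mult_at_bot[OF tendsto_const] filterlim_ident) (use c in auto)
  hence "(\<integral>\<^sup>+ s. ennreal (exp (- c * s)) * indicator {0..} s \<partial>lborel) = ennreal (0 - - exp (- c * 0) / c)"
    by (intro nn_integral_FTC_atLeast) (use c in \<open>auto intro!: derivative_eq_intros\<close>)
  thus "(\<integral>\<^sup>+ x. ennreal (exp (- c * (norm (x :: real \<times> real))\<^sup>2)) \<partial>lborel) < \<infinity>"
    using nn_integral_radial[of "\<lambda>s. ennreal (exp (- c * s))"]
    by (simp add: ennreal_mult_less_top flip: ennreal_mult)
qed auto

definition poly_growth :: "(real \<times> real \<Rightarrow> complex) \<Rightarrow> bool" where
  "poly_growth P \<longleftrightarrow> continuous_on UNIV P \<and> (\<exists>C n. \<forall>x. cmod (P x) \<le> C * (1 + (norm x)\<^sup>2) ^ n)"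

lemma poly_growthE:
  assumes "poly_growth P"
  obtains C n where "C \<ge> 0" "\<And>x. cmod (P x) \<le> C * (1 + (norm x)\<^sup>2) ^ n"
proof -
  from assms obtain C n where *: "\<And>x. cmod (P x) \<le> C * (1 + (norm x)\<^sup>2) ^ n"
    by (auto simp: poly_growth_def)
  moreover have "C \<ge> 0" using order_trans[OF norm_ge_zero *[of 0]] by simp
  ultimately show ?thesis using that by blast
qed

lemma poly_growth_const: "poly_growth (\<lambda>_. c)"
  unfolding poly_growth_def by (intro conjI continuous_intros exI[of _ "cmod c"] exI[of _ 0]) simp

lemma poly_growth_fst: "poly_growth (\<lambda>x. of_real (fst x))"
  and poly_growth_snd: "poly_growth (\<lambda>x. of_real (snd x))"
proof -
  have *: "\<bar>t\<bar> \<le> 1 + (t\<^sup>2 + s\<^sup>2)" for t s :: real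
    using abs_square_le_1[of t] by (sos)
  show "poly_growth (\<lambda>x. of_real (fst x))"
    unfolding poly_growth_def norm_prod_sq
    by (intro conjI continuous_intros exI[of _ 1]) (simp add: *)
  show "poly_growth (\<lambda>x. of_real (snd x))"
    unfolding poly_growth_def norm_prod_sq
    by (intro conjI continuous_intros exI[of _ 1]) (simp add: * add.commute[of "(fst _)\<^sup>2"])
qed

lemma poly_growth_mult:
  assumes "poly_growth P" "poly_growth Q"
  shows "poly_growth (\<lambda>x. P x * Q x)"
proof -
  obtain C n where 1: "C \<ge> 0" "\<And>x. cmod (P x) \<le> C * (1 + (norm x)\<^sup>2) ^ n"
    using poly_growthE[OF assms(1)] by blast
  obtain D m where 2: "D \<ge> 0" "\<And>x. cmod (Q x) \<le> D * (1 + (norm x)\<^sup>2) ^ m"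
    using poly_growthE[OF assms(2)] by blast
  have "cmod (P x * Q x) \<le> (C * D) * (1 + (norm x)\<^sup>2) ^ (n + m)" for x
    using mult_mono[OF 1(2)[of x] 2(2)[of x]] 1(1) 2(1)
    by (simp add: norm_mult power_add mult_ac)
  thus ?thesis using assms by (auto simp: poly_growth_def intro: continuous_on_mult)
qed

lemma poly_growth_add:
  assumes "poly_growth P" "poly_growth Q"
  shows "poly_growth (\<lambda>x. P x + Q x)"
proof -
  obtain C n where 1: "C \<ge> 0" "\<And>x. cmod (P x) \<le> C * (1 + (norm x)\<^sup>2) ^ n"
    using poly_growthE[OF assms(1)] by blast
  obtain D m where 2: "D \<ge> 0" "\<And>x. cmod (Q x) \<le> D * (1 + (norm x)\<^sup>2) ^ m"
    using poly_growthE[OF assms(2)] by blast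
  have "cmod (P x + Q x) \<le> (C + D) * (1 + (norm x)\<^sup>2) ^ (n + m)" for x
  proof -
    have "C * (1 + (norm x)\<^sup>2) ^ n \<le> C * (1 + (norm x)\<^sup>2) ^ (n + m)"
      "D * (1 + (norm x)\<^sup>2) ^ m \<le> D * (1 + (norm x)\<^sup>2) ^ (n + m)"
      using 1(1) 2(1) by (intro mult_left_mono power_increasing; simp)+
    thus ?thesis using norm_triangle_ineq[of "P x" "Q x"] 1(2)[of x] 2(2)[of x]
      by (simp add: algebra_simps)
  qed
  thus ?thesis using assms unfolding poly_growth_def by (blast intro: continuous_on_add)
qed

lemma poly_growth_power: "poly_growth P \<Longrightarrow> poly_growth (\<lambda>x. P x ^ n)"
  by (induction n) (auto intro: poly_growth_const poly_growth_mult)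

lemma poly_growth_norm: "poly_growth P \<Longrightarrow> poly_growth (\<lambda>x. of_real (cmod (P x)))"
  unfolding poly_growth_def by (auto intro!: continuous_on_of_real continuous_on_norm)

lemma poly_growth_gaussian_integrable:
  assumes P: "poly_growth P" and c: "c > 0"
  shows "integrable lborel (\<lambda>x. P x * of_real (exp (- c * (norm x)\<^sup>2)))"
proof -
  obtain C n where C: "C \<ge> 0" "\<And>x. cmod (P x) \<le> C * (1 + (norm x)\<^sup>2) ^ n"
    using poly_growthE[OF P] by blast
  \<comment> \<open>Half of the Gaussian absorbs the polynomial factor, because \<open>d * u \<le> exp (d * u)\<close>.\<close>
  define d where "d = c / (2 * (real n + 1))"
  have d: "d > 0" "real n * d \<le> c / 2" using c by (simp_all add: d_def field_simps)
  have cont: "continuous_on UNIV P" using P by (simp add: poly_growth_def)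
  show ?thesis
  proof (rule Bochner_Integration.integrable_bound)
    show "integrable lborel (\<lambda>x :: real \<times> real. C / d ^ n * exp (c / 2) * exp (- (c / 2) * (norm x)\<^sup>2))"
      using gaussian_integrable[of "c / 2"] c by (intro integrable_mult_right) auto
    have "(\<lambda>x. P x * of_real (exp (- c * (norm x)\<^sup>2))) \<in> borel_measurable borel"
      by (intro borel_measurable_continuous_onI continuous_intros cont)
    thus "(\<lambda>x. P x * of_real (exp (- c * (norm x)\<^sup>2))) \<in> borel_measurable lborel"
      by simp
    show "AE x in lborel. norm (P x * of_real (exp (- c * (norm x)\<^sup>2)))
        \<le> norm (C / d ^ n * exp (c / 2) * exp (- (c / 2) * (norm x)\<^sup>2))"
    proof (rule AE_I2)
      fix x :: "real \<times> real"
      define u where "u = 1 + (norm x)\<^sup>2"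
      have u: "u > 0" unfolding u_def by (simp add: add_pos_nonneg)
      have "(d * u) ^ n \<le> exp (d * u) ^ n"
        using d u exp_ge_add_one_self[of "d * u"] by (intro power_mono) (linarith, simp)
      also have "\<dots> = exp (real n * d * u)" by (simp add: exp_of_nat_mult mult.assoc)
      also have "\<dots> \<le> exp (c / 2 * u)" using d u by (simp add: mult_right_mono)
      finally have "u ^ n \<le> exp (c / 2 * u) / d ^ n" using d by (simp add: power_mult_distrib field_simps)
      hence "cmod (P x) \<le> C * (exp (c / 2 * u) / d ^ n)"
        using C(2)[of x] C(1) mult_left_mono[of "u ^ n" _ C] by (fastforce simp: u_def)
      hence "cmod (P x) * exp (- c * (norm x)\<^sup>2) \<le> C * (exp (c / 2 * u) / d ^ n) * exp (- c * (norm x)\<^sup>2)"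
        by (intro mult_right_mono) auto
      also have "\<dots> = C / d ^ n * (exp (c / 2 * u) * exp (- c * (norm x)\<^sup>2))" by simp
      also have "exp (c / 2 * u) * exp (- c * (norm x)\<^sup>2) = exp (c / 2) * exp (- (c / 2) * (norm x)\<^sup>2)"
        by (simp add: u_def algebra_simps flip: exp_add)
      finally show "norm (P x * of_real (exp (- c * (norm x)\<^sup>2)))
          \<le> norm (C / d ^ n * exp (c / 2) * exp (- (c / 2) * (norm x)\<^sup>2))"
        using C d by (simp add: norm_mult)
    qed
  qed
qed

lemma poly_growth_gaussian_L2:
  assumes P: "poly_growth P" and c: "c > 0"
  shows "(\<lambda>x. P x * of_real (exp (- c * (norm x)\<^sup>2))) \<in> L2"
proof -
  have "integrable lborel (\<lambda>x. of_real (cmod (P x)) ^ 2 * complex_of_real (exp (- (2 * c) * (norm x)\<^sup>2)))"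
    using c by (intro poly_growth_gaussian_integrable poly_growth_power poly_growth_norm P) auto
  hence "integrable lborel (\<lambda>x. Re (of_real (cmod (P x)) ^ 2 * complex_of_real (exp (- (2 * c) * (norm x)\<^sup>2))))"
    by (rule integrable_Re)
  also have "(\<lambda>x. Re (of_real (cmod (P x)) ^ 2 * complex_of_real (exp (- (2 * c) * (norm x)\<^sup>2))))
     = (\<lambda>x. (cmod (P x * of_real (exp (- c * (norm x)\<^sup>2))))\<^sup>2)"
    by (auto simp: norm_mult power_mult_distrib power2_eq_square simp flip: exp_add)
  finally show ?thesis
    using borel_measurable_integrable[OF poly_growth_gaussian_integrable[OF P c]]
    by (simp add: L2_def)
qed

lemma measurable_cnj [measurable]: "cnj \<in> borel_measurable borel"
  by (intro borel_measurable_continuous_onI continuous_intros)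

lemma L2_mult_integrable:
  assumes "u \<in> L2" "v \<in> L2"
  shows "integrable lborel (\<lambda>x. cmod (u x) * cmod (v x))"
    and "integrable lborel (\<lambda>x. u x * cnj (v x))"
proof -
  have [measurable]: "u \<in> borel_measurable borel" "v \<in> borel_measurable borel"
    using assms by (auto simp: L2_def)
  have I: "integrable lborel (\<lambda>x. (cmod (u x))\<^sup>2 + (cmod (v x))\<^sup>2)"
    using assms by (auto simp: L2_def)
  have *: "a * b \<le> a\<^sup>2 + b\<^sup>2" if "a \<ge> 0" "b \<ge> 0" for a b :: real
    using sum_squares_bound[of a b] mult_nonneg_nonneg[OF that] by linarith
  show "integrable lborel (\<lambda>x. cmod (u x) * cmod (v x))"
    by (rule Bochner_Integration.integrable_bound[OF I]) (auto simp: *)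
  show "integrable lborel (\<lambda>x. u x * cnj (v x))"
    by (rule Bochner_Integration.integrable_bound[OF I]) (auto simp: * norm_mult)
qed

lemma L2_inner_commute: "L2_inner u v = cnj (L2_inner v u)"
  unfolding L2_inner_def by (subst Bochner_Integration.integral_cnj[symmetric]) (simp add: mult.commute)

section \<open>Momentum operators and integration by parts\<close>

text \<open>Both momentum operators are instances, for \<open>e\<close> a coordinate direction and \<open>w\<close> the corresponding
  component of the vector potential (up to sign).\<close>

definition magnetic ::
    "real \<times> real \<Rightarrow> (real \<times> real \<Rightarrow> real) \<Rightarrow> (real \<times> real \<Rightarrow> complex) \<Rightarrow> real \<times> real \<Rightarrow> complex" where
  "magnetic e w f x = - \<i> * frechet_derivative f (at x) e + of_real (w x) * f x"

lemma smooth_has_derivative: "smooth f \<Longrightarrow> (f has_derivative frechet_derivative f (at x)) (at x)"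
  by (meson smooth_imp_C1 differentiable_def frechet_derivative_works)

lemma smooth_continuous: "smooth f \<Longrightarrow> continuous_on S f"
  using cont_diff.simps(1) smooth_def continuous_on_subset by blast

lemma smooth_continuous_dir_deriv:
  assumes "smooth f"
  shows "continuous_on S (\<lambda>x. frechet_derivative f (at x) e)"
proof -
  from smooth_imp_C1[OF assms] obtain g h where c: "continuous_on UNIV g" "continuous_on UNIV h"
    and d: "\<And>x. (f has_derivative (\<lambda>d. fst d *\<^sub>R g x + snd d *\<^sub>R h x)) (at x)"
    by blast
  have "frechet_derivative f (at x) e = fst e *\<^sub>R g x + snd e *\<^sub>R h x" for x
    using frechet_derivative_at[OF d, of x] by metis
  moreover have "continuous_on S (\<lambda>x. fst e *\<^sub>R g x + snd e *\<^sub>R h x)"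
    by (intro continuous_intros continuous_on_subset[OF c(1)] continuous_on_subset[OF c(2)]) auto
  ultimately show ?thesis by simp
qed

lemma momentum1_magnetic:
  assumes "smooth f"
  shows "momentum1 B f = magnetic (1, 0) (\<lambda>x. x \<bullet> (0, B / 2)) f"
proof
  fix x :: "real \<times> real"
  let ?D = "frechet_derivative f (at x)"
  have "((\<lambda>t. (t, snd x)) has_derivative (\<lambda>d. (d, 0))) (at (fst x))"
    by (auto intro!: derivative_eq_intros)
  from has_derivative_compose[OF this, of f ?D] smooth_has_derivative[OF assms, of x]
  have "((\<lambda>t. f (t, snd x)) has_derivative (\<lambda>d. ?D (d, 0))) (at (fst x))" by simp
  moreover have "(\<lambda>d. ?D (d, 0)) = (\<lambda>d. d *\<^sub>R ?D (1, 0))"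
  proof
    fix d
    show "?D (d, 0) = d *\<^sub>R ?D (1, 0)"
      using linear_scale[OF has_derivative_linear[OF smooth_has_derivative[OF assms, of x]], of d "(1, 0)"]
      by simp
  qed
  ultimately have "((\<lambda>t. f (t, snd x)) has_vector_derivative ?D (1, 0)) (at (fst x))"
    unfolding has_vector_derivative_def by metis
  thus "momentum1 B f x = magnetic (1, 0) (\<lambda>x. x \<bullet> (0, B / 2)) f x"
    by (simp add: momentum1_def partial1_def magnetic_def vector_derivative_at inner_prod_def mult.commute)
qed

lemma momentum2_magnetic:
  assumes "smooth f"
  shows "momentum2 B f = magnetic (0, 1) (\<lambda>x. x \<bullet> (- B / 2, 0)) f"
proof
  fix x :: "real \<times> real"
  let ?D = "frechet_derivative f (at x)"
  have "((\<lambda>t. (fst x, t)) has_derivative (\<lambda>d. (0, d))) (at (snd x))"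
    by (auto intro!: derivative_eq_intros)
  from has_derivative_compose[OF this, of f ?D] smooth_has_derivative[OF assms, of x]
  have "((\<lambda>t. f (fst x, t)) has_derivative (\<lambda>d. ?D (0, d))) (at (snd x))" by simp
  moreover have "(\<lambda>d. ?D (0, d)) = (\<lambda>d. d *\<^sub>R ?D (0, 1))"
  proof
    fix d
    show "?D (0, d) = d *\<^sub>R ?D (0, 1)"
      using linear_scale[OF has_derivative_linear[OF smooth_has_derivative[OF assms, of x]], of d "(0, 1)"]
      by simp
  qed
  ultimately have "((\<lambda>t. f (fst x, t)) has_vector_derivative ?D (0, 1)) (at (snd x))"
    unfolding has_vector_derivative_def by metis
  thus "momentum2 B f x = magnetic (0, 1) (\<lambda>x. x \<bullet> (- B / 2, 0)) f x"
    by (simp add: momentum2_def partial2_def magnetic_def vector_derivative_at inner_prod_def mult.commute)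
qed

lemma continuous_compact_support_integrable:
  fixes h :: "real \<times> real \<Rightarrow> complex"
  assumes "continuous_on UNIV h" "\<And>x. norm x > R \<Longrightarrow> h x = 0"
  shows "integrable lborel h"
proof -
  have "integrable lborel (\<lambda>x. indicator (cball 0 R) x *\<^sub>R h x)"
    using assms(1) by (intro borel_integrable_compact compact_cball) (blast intro: continuous_on_subset)
  also have "(\<lambda>x. indicator (cball 0 R) x *\<^sub>R h x) = h"
    using assms(2) by (fastforce simp: indicator_def)
  finally show ?thesis .
qed

lemma derivative_zero_outside:
  fixes h :: "real \<times> real \<Rightarrow> complex"
  assumes "(h has_derivative D) (at x)" and R: "\<And>y. norm y > R \<Longrightarrow> h y = 0" and x: "norm x > R"
  shows "D = (\<lambda>_. 0)"
proof -
  have "(h has_derivative (\<lambda>_. 0)) (at x)"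
  proof (rule has_derivative_transform_within_open[OF has_derivative_const[of 0]])
    show "open {y :: real \<times> real. R < norm y}"
      by (intro open_Collect_less continuous_intros)
  qed (use x R in auto)
  thus ?thesis using has_derivative_unique[OF assms(1)] by blast
qed

text \<open>The difference quotients in direction \<open>e\<close> have integral zero by translation invariance, and they
  converge boundedly to the derivative.\<close>

lemma integral_dir_deriv_compact_support:
  fixes h :: "real \<times> real \<Rightarrow> complex"
  assumes d: "\<And>x. (h has_derivative h' x) (at x)"
    and c: "continuous_on UNIV (\<lambda>x. h' x e)"
    and R: "\<And>x. norm x > R \<Longrightarrow> h x = 0"
  shows "(LINT x|lborel. h' x e) = 0"
proof -
  have hc: "continuous_on UNIV h"
    using has_derivative_continuous[OF d] by (simp add: continuous_on_eq_continuous_at)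
  note hI = continuous_compact_support_integrable[OF hc R]
  have zero: "h' x e = 0" if "norm x > R" for x
    using derivative_zero_outside[OF d R that] by simp
  obtain M where M: "\<And>x. cmod (h' x e) \<le> M"
  proof -
    have "bounded ((\<lambda>x. h' x e) ` cball 0 R)"
      using c by (intro compact_imp_bounded compact_continuous_image compact_cball)
        (blast intro: continuous_on_subset)
    then obtain M where "M > 0" "\<And>x. x \<in> cball 0 R \<Longrightarrow> cmod (h' x e) \<le> M"
      by (auto simp: bounded_pos)
    hence "cmod (h' x e) \<le> M" for x using zero[of x] by (cases "norm x > R") auto
    thus ?thesis using that by blast
  qed
  have line: "((\<lambda>s. h (x + s *\<^sub>R e)) has_derivative (\<lambda>r. r *\<^sub>R h' (x + s *\<^sub>R e) e)) (at s within S)" for x s S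
  proof -
    have "((\<lambda>s. x + s *\<^sub>R e) has_derivative (\<lambda>r. r *\<^sub>R e)) (at s within S)"
      by (auto intro!: derivative_eq_intros)
    from has_derivative_compose[OF this d]
    have "((\<lambda>s. h (x + s *\<^sub>R e)) has_derivative (\<lambda>r. h' (x + s *\<^sub>R e) (r *\<^sub>R e))) (at s within S)" .
    thus ?thesis by (simp add: linear_scale[OF has_derivative_linear[OF d]])
  qed
  have lip: "cmod (h (x + t *\<^sub>R e) - h x) \<le> M * t" if "t \<ge> 0" for x t
  proof -
    have "cmod (h (x + t *\<^sub>R e) - h (x + 0 *\<^sub>R e)) \<le> M * norm (t - 0)"
    proof (rule differentiable_bound[where S = "{0..t}"])
      fix s assume "s \<in> {0..t}"
      show "((\<lambda>s. h (x + s *\<^sub>R e)) has_derivative (\<lambda>r. r *\<^sub>R h' (x + s *\<^sub>R e) e)) (at s within {0..t})"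
        by (rule line)
      show "onorm (\<lambda>r. r *\<^sub>R h' (x + s *\<^sub>R e) e) \<le> M"
        by (rule onorm_le) (use mult_right_mono[OF M[of "x + s *\<^sub>R e"] abs_ge_zero] in \<open>simp add: mult.commute\<close>)
    qed (use that in auto)
    thus ?thesis using that by simp
  qed
  define t where "t n = inverse (real (Suc n))" for n
  have t: "0 < t n" "t n \<le> 1" for n by (simp_all add: t_def field_simps)
  define q where "q n x = (h (x + t n *\<^sub>R e) - h x) /\<^sub>R t n" for n x
  have "(\<lambda>n. LINT x|lborel. q n x) \<longlonglongrightarrow> (LINT x|lborel. h' x e)"
  proof (rule integral_dominated_convergence)
    have [measurable]: "h \<in> borel_measurable borel" "(\<lambda>x. h' x e) \<in> borel_measurable borel"
      using hc c by (auto intro: borel_measurable_continuous_onI)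
    show "(\<lambda>x. h' x e) \<in> borel_measurable lborel" by simp
    show "q n \<in> borel_measurable lborel" for n unfolding q_def[abs_def] by measurable
    show "integrable lborel (\<lambda>x. indicator (cball 0 (R + norm e)) x *\<^sub>R M)"
      by (intro borel_integrable_compact compact_cball continuous_intros)
    show "AE x in lborel. (\<lambda>n. q n x) \<longlonglongrightarrow> h' x e"
    proof (rule AE_I2)
      fix x
      have "((\<lambda>s. norm (h (x + s *\<^sub>R e) - h x - s *\<^sub>R h' x e) / norm s) \<longlongrightarrow> 0) (at 0)"
        using line[of x 0 UNIV] by (simp add: has_derivative_iff_norm)
      moreover have "eventually (\<lambda>s. norm (h (x + s *\<^sub>R e) - h x - s *\<^sub>R h' x e) / norm s
          = norm ((h (x + s *\<^sub>R e) - h x) /\<^sub>R s - h' x e)) (at 0)"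
        unfolding eventually_at_filter
      proof (intro always_eventually allI impI)
        fix s :: real assume "s \<noteq> 0"
        hence "(h (x + s *\<^sub>R e) - h x) /\<^sub>R s - h' x e = (h (x + s *\<^sub>R e) - h x - s *\<^sub>R h' x e) /\<^sub>R s"
          by (simp add: scaleR_diff_right)
        thus "norm (h (x + s *\<^sub>R e) - h x - s *\<^sub>R h' x e) / norm s
          = norm ((h (x + s *\<^sub>R e) - h x) /\<^sub>R s - h' x e)" by (simp add: divide_inverse)
      qed
      ultimately have "((\<lambda>s. norm ((h (x + s *\<^sub>R e) - h x) /\<^sub>R s - h' x e)) \<longlongrightarrow> 0) (at 0)"
        by (rule Lim_transform_eventually)
      hence "((\<lambda>s. (h (x + s *\<^sub>R e) - h x) /\<^sub>R s) \<longlongrightarrow> h' x e) (at 0)"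
        by (rule LIM_zero_cancel[OF tendsto_norm_zero_cancel])
      moreover have "filterlim t (at 0) sequentially"
        unfolding filterlim_at using t(1) LIMSEQ_inverse_real_of_nat
        by (auto simp: t_def[abs_def] intro!: always_eventually)
      ultimately show "(\<lambda>n. q n x) \<longlonglongrightarrow> h' x e"
        unfolding q_def by (rule filterlim_compose)
    qed
    show "AE x in lborel. norm (q n x) \<le> indicator (cball 0 (R + norm e)) x *\<^sub>R M" for n
    proof (rule AE_I2)
      fix x
      show "norm (q n x) \<le> indicator (cball 0 (R + norm e)) x *\<^sub>R M"
      proof (cases "x \<in> cball 0 (R + norm e)")
        case True
        have "norm (q n x) = cmod (h (x + t n *\<^sub>R e) - h x) / t n"
          using t[of n] by (simp add: q_def divide_inverse)
        also have "\<dots> \<le> M"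
          using lip[of "t n" x] t[of n] by (simp add: divide_le_eq)
        finally show ?thesis using True by simp
      next
        case False
        have "norm (x + t n *\<^sub>R e) \<ge> norm x - t n * norm e"
          using norm_diff_ineq[of x "t n *\<^sub>R e"] t[of n] by simp
        moreover have "t n * norm e \<le> norm e" using t[of n] by (simp add: mult_left_le_one_le)
        ultimately have "norm (x + t n *\<^sub>R e) > R" "norm x > R"
          using False norm_ge_zero[of e] unfolding mem_cball_0 by linarith+
        thus ?thesis using False R by (simp add: q_def)
      qed
    qed
  qed
  moreover have "(LINT x|lborel. q n x) = 0" for n
  proof -
    have T: "integrable lborel (\<lambda>x. h (t n *\<^sub>R e + x))" "(LINT x|lborel. h (t n *\<^sub>R e + x)) = (LINT x|lborel. h x)"
      using integrable_distr_eq[of "(+) (t n *\<^sub>R e)" lborel borel h]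
        integral_distr[of "(+) (t n *\<^sub>R e)" lborel borel h] hI hc
      by (auto simp: lborel_distr_plus borel_measurable_continuous_onI)
    show ?thesis unfolding q_def using T hI by (simp add: add.commute)
  qed
  ultimately show ?thesis by (simp add: LIMSEQ_const_iff)
qed

lemma test_function_smooth: "\<phi> \<in> test_functions \<Longrightarrow> smooth \<phi>"
  by (simp add: test_functions_def smooth_def)

lemma test_function_bounded_support:
  assumes "\<phi> \<in> test_functions"
  obtains R where "\<And>x. norm x > R \<Longrightarrow> \<phi> x = 0"
proof -
  have "bounded {x. \<phi> x \<noteq> 0}"
    using assms closure_subset bounded_subset by (auto simp: test_functions_def dest!: compact_imp_bounded)
  then obtain R where "\<forall>x\<in>{x. \<phi> x \<noteq> 0}. norm x \<le> R" by (auto simp: bounded_iff)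
  thus ?thesis using that[of R] by force
qed

lemma test_functionI:
  assumes "smooth \<phi>" "\<And>x. norm x > R \<Longrightarrow> \<phi> x = 0"
  shows "\<phi> \<in> test_functions"
proof -
  have "{x. \<phi> x \<noteq> 0} \<subseteq> cball 0 R" using assms(2) by force
  hence "bounded {x. \<phi> x \<noteq> 0}" using bounded_cball bounded_subset by blast
  thus ?thesis using assms(1) by (simp add: test_functions_def smooth_def compact_closure)
qed

text \<open>The two integrands differ by \<open>\<i>\<close> times the derivative of \<open>f\<close> times the conjugate of \<open>\<phi>\<close> in
  direction \<open>e\<close>, which has compact support. Hence the classical momentum of a smooth function is
  also its distributional one.\<close>

lemma magnetic_symmetric:
  assumes f: "smooth f" and \<phi>: "\<phi> \<in> test_functions" and w: "continuous_on UNIV w"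
  shows "L2_inner f (magnetic e w \<phi>) = L2_inner (magnetic e w f) \<phi>"
proof -
  note s\<phi> = test_function_smooth[OF \<phi>]
  obtain R where R: "\<And>x. norm x > R \<Longrightarrow> \<phi> x = 0"
    using test_function_bounded_support[OF \<phi>] by blast
  let ?Df = "\<lambda>x. frechet_derivative f (at x)" and ?D\<phi> = "\<lambda>x. frechet_derivative \<phi> (at x)"
  define h' where "h' x d = f x * cnj (?D\<phi> x d) + ?Df x d * cnj (\<phi> x)" for x d
  have D\<phi>0: "?D\<phi> x e = 0" if "norm x > R" for x
    using derivative_zero_outside[OF smooth_has_derivative[OF s\<phi>] R that] by simp
  note c = smooth_continuous[OF f, of UNIV] smooth_continuous[OF s\<phi>, of UNIV]
    smooth_continuous_dir_deriv[OF f, of UNIV e] smooth_continuous_dir_deriv[OF s\<phi>, of UNIV e]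
  have zero: "(LINT x|lborel. h' x e) = 0"
  proof (rule integral_dir_deriv_compact_support)
    show "((\<lambda>x. f x * cnj (\<phi> x)) has_derivative h' x) (at x)" for x
      unfolding h'_def
      by (intro has_derivative_mult smooth_has_derivative f
          bounded_linear.has_derivative[OF bounded_linear_cnj] s\<phi>)
    show "continuous_on UNIV (\<lambda>x. h' x e)"
      unfolding h'_def by (intro continuous_intros c)
    show "f x * cnj (\<phi> x) = 0" if "norm x > R" for x using R[OF that] by simp
  qed
  have "L2_inner f (magnetic e w \<phi>) - L2_inner (magnetic e w f) \<phi>
      = (LINT x|lborel. f x * cnj (magnetic e w \<phi> x) - magnetic e w f x * cnj (\<phi> x))"
    unfolding L2_inner_def magnetic_def
    by (intro Bochner_Integration.integral_diff[symmetric] continuous_compact_support_integrable[of _ R]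
          continuous_intros c w) (simp_all add: D\<phi>0 R)
  also have "(\<lambda>x. f x * cnj (magnetic e w \<phi> x) - magnetic e w f x * cnj (\<phi> x)) = (\<lambda>x. \<i> * h' x e)"
    by (simp add: fun_eq_iff magnetic_def h'_def algebra_simps)
  also have "(LINT x|lborel. \<i> * h' x e) = 0" using zero by simp
  finally show ?thesis by simp
qed

lemma magnetic_cutoff:
  assumes "smooth g"
  shows "magnetic e w (\<lambda>x. cutoff n x * g x) x = cutoff n x * magnetic e w g x - \<i> * (cutoff_slope n x e * g x)"
proof -
  have "((\<lambda>x. cutoff n x * g x) has_derivative
      (\<lambda>d. cutoff n x * frechet_derivative g (at x) d + cutoff_slope n x d * g x)) (at x)"
    by (intro has_derivative_mult cutoff_has_derivative smooth_has_derivative assms)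
  from frechet_derivative_at[OF this, symmetric] show ?thesis
    by (simp add: magnetic_def algebra_simps)
qed

text \<open>The distributional identity extends from test functions to smooth functions that decay: the cutoffs of
  \<open>g\<close> are test functions, and the extra term from differentiating the cutoff is bounded by a
  multiple of \<open>\<bar>x\<bar> \<bar>g x\<bar>\<close> and tends to \<open>0\<close> at every point.\<close>

lemma weakly_magnetic_pairing:
  assumes w: "weakly (magnetic e w) v q" and v: "v \<in> L2" and q: "q \<in> L2"
    and g: "smooth g" "g \<in> L2" and mg: "magnetic e w g \<in> L2"
    and xg: "(\<lambda>x. of_real (norm x) * g x) \<in> L2"
  shows "L2_inner v (magnetic e w g) = L2_inner q g"
proof -
  have [measurable]: "v \<in> borel_measurable borel" "q \<in> borel_measurable borel" "g \<in> borel_measurable borel"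
    "magnetic e w g \<in> borel_measurable borel" "cutoff n \<in> borel_measurable borel" for n
    using v q g mg smooth_continuous[OF smooth_cutoff]
    by (auto simp: L2_def intro: borel_measurable_continuous_onI)
  have slope[measurable]: "(\<lambda>x. cutoff_slope n x e) \<in> borel_measurable borel" for n
  proof -
    have "cutoff_slope n x = frechet_derivative (cutoff n) (at x)" for x
      by (rule frechet_derivative_at[OF cutoff_has_derivative])
    thus ?thesis using smooth_continuous_dir_deriv[OF smooth_cutoff, of UNIV n e]
      by (auto intro: borel_measurable_continuous_onI)
  qed
  define g' where "g' n x = cutoff n x * g x" for n x
  have "g' n \<in> test_functions" for n
    by (rule test_functionI[of _ "real (Suc n)"])
       (auto simp: g'_def[abs_def] cutoff_outside intro!: smooth_mult smooth_cutoff g)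
  hence eq: "L2_inner v (magnetic e w (g' n)) = L2_inner q (g' n)" for n
    using w by (auto simp: weakly_def)
  have "(\<lambda>n. L2_inner q (g' n)) \<longlonglongrightarrow> L2_inner q g"
    unfolding L2_inner_def
  proof (rule integral_dominated_convergence)
    show "integrable lborel (\<lambda>x. exp 1 * (cmod (q x) * cmod (g x)))"
      by (intro integrable_mult_right L2_mult_integrable q g)
    show "AE x in lborel. (\<lambda>n. q x * cnj (g' n x)) \<longlonglongrightarrow> q x * cnj (g x)"
    proof (rule AE_I2)
      fix x
      have "(\<lambda>n. q x * cnj (g' n x)) \<longlonglongrightarrow> q x * cnj (1 * g x)"
        unfolding g'_def by (intro tendsto_intros cutoff_tendsto)
      thus "(\<lambda>n. q x * cnj (g' n x)) \<longlonglongrightarrow> q x * cnj (g x)" by simp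
    qed
    show "AE x in lborel. norm (q x * cnj (g' n x)) \<le> exp 1 * (cmod (q x) * cmod (g x))" for n
    proof (rule AE_I2)
      fix x
      show "norm (q x * cnj (g' n x)) \<le> exp 1 * (cmod (q x) * cmod (g x))"
        using mult_right_mono[OF norm_cutoff_le[of n x], of "cmod (q x) * cmod (g x)"]
        by (simp add: g'_def norm_mult mult_ac)
    qed
  qed (simp_all add: g'_def[abs_def])
  moreover have "(\<lambda>n. L2_inner v (magnetic e w (g' n))) \<longlonglongrightarrow> L2_inner v (magnetic e w g)"
    unfolding L2_inner_def
  proof (rule integral_dominated_convergence)
    show "integrable lborel (\<lambda>x. exp 1 * (cmod (v x) * cmod (magnetic e w g x)) +
        4 * exp 1 * norm e * (cmod (v x) * cmod (of_real (norm x) * g x)))"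
      by (intro Bochner_Integration.integrable_add integrable_mult_right L2_mult_integrable v mg xg)
    have m: "magnetic e w (g' n) x = cutoff n x * magnetic e w g x - \<i> * (cutoff_slope n x e * g x)" for n x
      unfolding g'_def[abs_def] by (rule magnetic_cutoff[OF g(1)])
    show "(\<lambda>x. v x * cnj (magnetic e w (g' n) x)) \<in> borel_measurable lborel" for n
      unfolding m by simp
    show "AE x in lborel. (\<lambda>n. v x * cnj (magnetic e w (g' n) x)) \<longlonglongrightarrow> v x * cnj (magnetic e w g x)"
    proof (rule AE_I2)
      fix x
      have "(\<lambda>n. v x * cnj (magnetic e w (g' n) x)) \<longlonglongrightarrow> v x * cnj (1 * magnetic e w g x - \<i> * (0 * g x))"
        unfolding m by (intro tendsto_intros cutoff_tendsto cutoff_slope_tendsto)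
      thus "(\<lambda>n. v x * cnj (magnetic e w (g' n) x)) \<longlonglongrightarrow> v x * cnj (magnetic e w g x)" by simp
    qed
    show "AE x in lborel. norm (v x * cnj (magnetic e w (g' n) x)) \<le>
       exp 1 * (cmod (v x) * cmod (magnetic e w g x)) +
        4 * exp 1 * norm e * (cmod (v x) * cmod (of_real (norm x) * g x))" for n
    proof (rule AE_I2)
      fix x
      have "inverse (real (Suc n)) \<le> 1" by (simp add: field_simps)
      hence small: "(inverse (real (Suc n)))\<^sup>2 \<le> 1" by (intro power_le_one) auto
      have "cmod (cutoff_slope n x e) \<le> (inverse (real (Suc n)))\<^sup>2 * (4 * exp 1 * norm e * norm x)"
        by (rule norm_cutoff_slope_le)
      also have "\<dots> \<le> 1 * (4 * exp 1 * norm e * norm x)"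
        by (intro mult_right_mono small) auto
      finally have "cmod (cutoff_slope n x e) \<le> 4 * exp 1 * norm e * norm x" by simp
      hence "cmod (cutoff_slope n x e) * cmod (g x) \<le> 4 * exp 1 * norm e * norm x * cmod (g x)"
        by (rule mult_right_mono) simp
      moreover have "cmod (cutoff n x) * cmod (magnetic e w g x) \<le> exp 1 * cmod (magnetic e w g x)"
        by (intro mult_right_mono norm_cutoff_le) simp
      ultimately have "cmod (magnetic e w (g' n) x) \<le>
          exp 1 * cmod (magnetic e w g x) + 4 * exp 1 * norm e * norm x * cmod (g x)"
        unfolding m
        using norm_triangle_ineq4[of "cutoff n x * magnetic e w g x" "\<i> * (cutoff_slope n x e * g x)"]
        by (simp add: norm_mult)
      from mult_left_mono[OF this, of "cmod (v x)"]
      show "norm (v x * cnj (magnetic e w (g' n) x)) \<le>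
       exp 1 * (cmod (v x) * cmod (magnetic e w g x)) +
        4 * exp 1 * norm e * (cmod (v x) * cmod (of_real (norm x) * g x))"
        by (simp add: norm_mult algebra_simps)
    qed
  qed simp
  ultimately show ?thesis unfolding eq by (rule LIMSEQ_unique[rotated])
qed

section \<open>Fock--Darwin eigenfunctions\<close>

definition complex_coord :: "real \<times> real \<Rightarrow> complex" where
  "complex_coord x = of_real (fst x) + \<i> * of_real (snd x)"

definition gauss :: "real \<Rightarrow> real \<times> real \<Rightarrow> complex" where
  "gauss \<Omega> x = of_real (exp (- (\<Omega> / 2) * (norm x)\<^sup>2))"

definition orbital :: "real \<Rightarrow> nat \<Rightarrow> real \<times> real \<Rightarrow> complex" where
  "orbital \<Omega> k x = complex_coord x ^ k * gauss \<Omega> x"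

text \<open>The factor by which a momentum operator multiplies the Gaussian, for the linear potential
  \<open>x \<bullet> c\<close>; it is a linear form in \<open>x\<close>, hence equal to its own derivative.\<close>

definition gauss_symbol :: "real \<Rightarrow> real \<times> real \<Rightarrow> real \<times> real \<Rightarrow> real \<times> real \<Rightarrow> complex" where
  "gauss_symbol \<Omega> e c x = \<i> * of_real (\<Omega> * (x \<bullet> e)) + of_real (x \<bullet> c)"

lemma complex_coord_has_derivative: "(complex_coord has_derivative complex_coord) (at x)"
  unfolding complex_coord_def[abs_def] by (auto intro!: derivative_eq_intros)

lemma gauss_symbol_has_derivative: "(gauss_symbol \<Omega> e c has_derivative gauss_symbol \<Omega> e c) (at x)"
  unfolding gauss_symbol_def[abs_def] by (auto intro!: derivative_eq_intros)

lemma smooth_inner: "smooth (\<lambda>x. of_real (x \<bullet> c))"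
  using smooth_add[OF smooth_mult[OF smooth_fst smooth_const[of "of_real (fst c)"]]
      smooth_mult[OF smooth_snd smooth_const[of "of_real (snd c)"]]]
  by (simp add: inner_prod_def)

lemma poly_growth_inner: "poly_growth (\<lambda>x. of_real (x \<bullet> c))"
  using poly_growth_add[OF poly_growth_mult[OF poly_growth_fst poly_growth_const[of "of_real (fst c)"]]
      poly_growth_mult[OF poly_growth_snd poly_growth_const[of "of_real (snd c)"]]]
  by (simp add: inner_prod_def)

lemma smooth_complex_coord: "smooth complex_coord"
  unfolding complex_coord_def[abs_def] by (intro smooth_add smooth_mult smooth_fst smooth_snd smooth_const)

lemma poly_growth_complex_coord: "poly_growth complex_coord"
  unfolding complex_coord_def[abs_def]
  by (intro poly_growth_add poly_growth_mult poly_growth_fst poly_growth_snd poly_growth_const)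

lemma smooth_gauss_symbol: "smooth (gauss_symbol \<Omega> e c)"
  unfolding gauss_symbol_def[abs_def] of_real_mult
  by (intro smooth_add smooth_mult smooth_inner smooth_const)

lemma poly_growth_gauss_symbol: "poly_growth (gauss_symbol \<Omega> e c)"
  unfolding gauss_symbol_def[abs_def] of_real_mult
  by (intro poly_growth_add poly_growth_mult poly_growth_inner poly_growth_const)

lemma smooth_gauss: "smooth (gauss \<Omega>)"
  using smooth_radial[where F = "\<lambda>_. exp" and a = 0 and b = "- (\<Omega> / 2)"]
  by (simp add: gauss_def[abs_def] DERIV_exp)

lemma gauss_L2:
  assumes "poly_growth P" "\<Omega> > 0"
  shows "(\<lambda>x. P x * gauss \<Omega> x) \<in> L2"
  unfolding gauss_def using assms by (intro poly_growth_gaussian_L2) auto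

lemma gauss_L2_norm:
  assumes "poly_growth P" "\<Omega> > 0"
  shows "(\<lambda>x. of_real (norm x) * (P x * gauss \<Omega> x)) \<in> L2"
proof -
  have "norm x = cmod (complex_coord x)" for x
    by (cases x) (simp add: complex_coord_def norm_Pair cmod_def)
  thus ?thesis
    using gauss_L2[OF poly_growth_mult[OF poly_growth_norm[OF poly_growth_complex_coord] assms(1)] assms(2)]
    by (simp add: mult.assoc)
qed

lemma magnetic_gauss:
  assumes "(P has_derivative D) (at x)"
  shows "magnetic e (\<lambda>x. x \<bullet> c) (\<lambda>x. P x * gauss \<Omega> x) x
     = (- \<i> * D e + gauss_symbol \<Omega> e c x * P x) * gauss \<Omega> x"
proof -
  have "(gauss \<Omega> has_derivative (\<lambda>d. - of_real (\<Omega> * (x \<bullet> d)) * gauss \<Omega> x)) (at x)"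
    using has_derivative_radial[of exp "exp (0 + - (\<Omega> / 2) * (norm x)\<^sup>2)" 0 "- (\<Omega> / 2)" x]
    by (simp add: gauss_def[abs_def] DERIV_exp) (erule has_derivative_eq_rhs,
       simp add: fun_eq_iff scaleR_conv_of_real inner_prod_def algebra_simps)
  from frechet_derivative_at[OF has_derivative_mult[OF assms this], symmetric]
  show ?thesis by (simp add: magnetic_def gauss_symbol_def algebra_simps)
qed

lemma magnetic_orbital:
  "magnetic e (\<lambda>x. x \<bullet> c) (orbital \<Omega> k)
     = (\<lambda>x. (- \<i> * (of_nat k * complex_coord e * complex_coord x ^ (k - 1)) + gauss_symbol \<Omega> e c x * complex_coord x ^ k) * gauss \<Omega> x)"
proof
  fix x
  have "((\<lambda>x. complex_coord x ^ k) has_derivative (\<lambda>d. of_nat k * complex_coord d * complex_coord x ^ (k - 1))) (at x)"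
    by (rule has_derivative_power[OF complex_coord_has_derivative])
  from magnetic_gauss[OF this] show "magnetic e (\<lambda>x. x \<bullet> c) (orbital \<Omega> k) x
     = (- \<i> * (of_nat k * complex_coord e * complex_coord x ^ (k - 1)) + gauss_symbol \<Omega> e c x * complex_coord x ^ k) * gauss \<Omega> x"
    unfolding orbital_def[abs_def] .
qed

lemma magnetic_magnetic_orbital:
  "magnetic e (\<lambda>x. x \<bullet> c) (magnetic e (\<lambda>x. x \<bullet> c) (orbital \<Omega> k))
     = (\<lambda>x. ((gauss_symbol \<Omega> e c x ^ 2 - \<i> * gauss_symbol \<Omega> e c e) * complex_coord x ^ k
             - 2 * \<i> * of_nat k * complex_coord e * gauss_symbol \<Omega> e c x * complex_coord x ^ (k - 1)
             - of_nat k * of_nat (k - 1) * complex_coord e ^ 2 * complex_coord x ^ (k - 1 - 1)) * gauss \<Omega> x)"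
proof
  fix x
  have "((\<lambda>x. - \<i> * (of_nat k * complex_coord e * complex_coord x ^ (k - 1)) + gauss_symbol \<Omega> e c x * complex_coord x ^ k) has_derivative
     (\<lambda>d. - \<i> * (of_nat k * complex_coord e * (of_nat (k - 1) * complex_coord d * complex_coord x ^ (k - 1 - 1)))
        + (gauss_symbol \<Omega> e c x * (of_nat k * complex_coord d * complex_coord x ^ (k - 1)) + gauss_symbol \<Omega> e c d * complex_coord x ^ k))) (at x)"
    by (intro has_derivative_add has_derivative_mult has_derivative_mult_right has_derivative_power
        complex_coord_has_derivative gauss_symbol_has_derivative)
  note mm = magnetic_gauss[OF this, of e c \<Omega>]
  show "magnetic e (\<lambda>x. x \<bullet> c) (magnetic e (\<lambda>x. x \<bullet> c) (orbital \<Omega> k)) x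
     = ((gauss_symbol \<Omega> e c x ^ 2 - \<i> * gauss_symbol \<Omega> e c e) * complex_coord x ^ k
             - 2 * \<i> * of_nat k * complex_coord e * gauss_symbol \<Omega> e c x * complex_coord x ^ (k - 1)
             - of_nat k * of_nat (k - 1) * complex_coord e ^ 2 * complex_coord x ^ (k - 1 - 1)) * gauss \<Omega> x"
    unfolding magnetic_orbital mm by (simp add: algebra_simps power2_eq_square)
qed

text \<open>The terms in \<open>z\<^bsup>k - 2\<^esup>\<close> cancel because the squared directions are \<open>1\<close> and \<open>\<i>\<^sup>2 = - 1\<close>. The squares
  of the two symbols add up to \<open>- \<omega>\<^sup>2 \<bar>x\<bar>\<^sup>2\<close>, which removes the harmonic potential, and the cross
  terms recombine to a multiple of \<open>z\<close>, which raises \<open>z\<^bsup>k - 1\<^esup>\<close> back to \<open>z\<^sup>k\<close>.\<close>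

lemma fock_darwin_eigenfunction:
  fixes B \<omega> \<Omega> :: real
  assumes "\<Omega>\<^sup>2 = B\<^sup>2 / 4 + \<omega>\<^sup>2"
  shows "magnetic (1, 0) (\<lambda>x. x \<bullet> (0, B / 2)) (magnetic (1, 0) (\<lambda>x. x \<bullet> (0, B / 2)) (orbital \<Omega> k)) x
     + magnetic (0, 1) (\<lambda>x. x \<bullet> (- B / 2, 0)) (magnetic (0, 1) (\<lambda>x. x \<bullet> (- B / 2, 0)) (orbital \<Omega> k)) x
     + of_real (\<omega>\<^sup>2 * (norm x)\<^sup>2) * orbital \<Omega> k x
     = of_real (2 * \<Omega> + real k * (2 * \<Omega> - B)) * orbital \<Omega> k x"
proof -
  let ?a = "gauss_symbol \<Omega> (1, 0) (0, B / 2)" and ?b = "gauss_symbol \<Omega> (0, 1) (- B / 2, 0)"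
  have squares: "?a x ^ 2 + ?b x ^ 2 = - of_real (\<omega>\<^sup>2 * (norm x)\<^sup>2)"
  proof -
    have "?a x ^ 2 + ?b x ^ 2 = - of_real ((\<Omega>\<^sup>2 - B\<^sup>2 / 4) * (norm x)\<^sup>2)"
      unfolding norm_prod_sq
      by (simp add: gauss_symbol_def inner_prod_def complex_eq_iff power2_eq_square algebra_simps)
    thus ?thesis using assms by simp
  qed
  have cross: "\<i> * (?a x + \<i> * ?b x) = - of_real (\<Omega> - B / 2) * complex_coord x"
    by (simp add: gauss_symbol_def complex_coord_def inner_prod_def complex_eq_iff algebra_simps)
  have const_terms: "\<i> * ?a (1, 0) + \<i> * ?b (0, 1) = - of_real (2 * \<Omega>)"
    by (simp add: gauss_symbol_def inner_prod_def complex_eq_iff)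
  \<comment> \<open>Stated with the factor \<open>k\<close> because \<open>k - 1\<close> is truncated at \<open>k = 0\<close>.\<close>
  have zpow: "of_nat k * (complex_coord x * complex_coord x ^ (k - 1)) = of_nat k * complex_coord x ^ k"
    by (cases k) auto
  have "(?a x ^ 2 - \<i> * ?a (1, 0)) * complex_coord x ^ k
          - 2 * \<i> * of_nat k * complex_coord (1, 0) * ?a x * complex_coord x ^ (k - 1)
          - of_nat k * of_nat (k - 1) * complex_coord (1, 0) ^ 2 * complex_coord x ^ (k - 1 - 1)
        + ((?b x ^ 2 - \<i> * ?b (0, 1)) * complex_coord x ^ k
          - 2 * \<i> * of_nat k * complex_coord (0, 1) * ?b x * complex_coord x ^ (k - 1)
          - of_nat k * of_nat (k - 1) * complex_coord (0, 1) ^ 2 * complex_coord x ^ (k - 1 - 1))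
      = ((?a x ^ 2 + ?b x ^ 2) - (\<i> * ?a (1, 0) + \<i> * ?b (0, 1))) * complex_coord x ^ k
          - 2 * of_nat k * (\<i> * (?a x + \<i> * ?b x)) * complex_coord x ^ (k - 1)"
    by (simp add: complex_coord_def algebra_simps)
  also have "\<dots> = (- of_real (\<omega>\<^sup>2 * (norm x)\<^sup>2) + of_real (2 * \<Omega>)) * complex_coord x ^ k
          + 2 * of_real (\<Omega> - B / 2) * (of_nat k * (complex_coord x * complex_coord x ^ (k - 1)))"
    unfolding squares const_terms cross by (simp add: algebra_simps)
  finally show ?thesis
    unfolding magnetic_magnetic_orbital orbital_def zpow
    by (simp add: distrib_right[symmetric]) (simp add: algebra_simps)
qed

lemma weakly_momentum_iff:
  "weakly (momentum1 B) u p \<longleftrightarrow> weakly (magnetic (1, 0) (\<lambda>x. x \<bullet> (0, B / 2))) u p"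
  "weakly (momentum2 B) u p \<longleftrightarrow> weakly (magnetic (0, 1) (\<lambda>x. x \<bullet> (- B / 2, 0))) u p"
  by (simp_all add: weakly_def momentum1_magnetic momentum2_magnetic test_function_smooth)

lemma gauss_integration_by_parts:
  assumes "\<Omega> > 0" "smooth P" "poly_growth P" and f: "f = (\<lambda>x. P x * gauss \<Omega> x)"
    and Q: "poly_growth Q" "magnetic e w f = (\<lambda>x. Q x * gauss \<Omega> x)"
    and v: "v \<in> L2" "q \<in> L2" "weakly (magnetic e w) v q"
  shows "L2_inner (magnetic e w f) v = L2_inner f q"
proof -
  have "L2_inner v (magnetic e w f) = L2_inner q f"
  proof (rule weakly_magnetic_pairing[OF v(3,1,2)])
    show "smooth f" unfolding f by (intro smooth_mult assms smooth_gauss)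
    show "f \<in> L2" unfolding f by (intro gauss_L2 assms)
    show "magnetic e w f \<in> L2" unfolding Q(2) by (intro gauss_L2 assms)
    show "(\<lambda>x. of_real (norm x) * f x) \<in> L2" unfolding f by (intro gauss_L2_norm assms)
  qed
  thus ?thesis by (metis L2_inner_commute)
qed

lemmas smooth_intros = smooth_add smooth_mult smooth_const smooth_power smooth_complex_coord smooth_gauss_symbol
lemmas poly_growth_intros = poly_growth_add poly_growth_mult poly_growth_const poly_growth_power
  poly_growth_complex_coord poly_growth_gauss_symbol

lemma L2_scale: "f \<in> L2 \<Longrightarrow> (\<lambda>x. c * f x) \<in> L2"
  by (auto simp: L2_def norm_mult power_mult_distrib)

text \<open>Applying integration by parts to the two momenta of the orbital moves both momentum operators onto it,
  for any \<open>v\<close> in the form domain. What then stands against \<open>v\<close> is the classical operator applied to the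
  orbital, and the pointwise eigenvalue equation applies.\<close>

lemma landau_op_orbital:
  fixes B \<omega> \<Omega> \<mu> :: real and k :: nat
  assumes \<Omega>: "\<Omega> > 0" "\<Omega>\<^sup>2 = B\<^sup>2 / 4 + \<omega>\<^sup>2"
  defines "V \<equiv> \<lambda>x :: real \<times> real. \<omega>\<^sup>2 * (fst x)\<^sup>2 + \<omega>\<^sup>2 * (snd x)\<^sup>2 - \<mu>"
  defines "E \<equiv> 2 * \<Omega> + real k * (2 * \<Omega> - B) - \<mu>"
  shows "landau_op B V (orbital \<Omega> k) (\<lambda>x. of_real E * orbital \<Omega> k x)"
proof -
  let ?u = "orbital \<Omega> k"
  \<comment> \<open>The two coordinates are indexed by a truth value, so that each fact is proved once for both.\<close>
  define e c where "e j = (if j then (1, 0) else (0, 1 :: real) :: real \<times> real)"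
    and "c j = (if j then (0, B / 2) else (- B / 2, 0) :: real \<times> real)" for j
  define M where "M j = magnetic (e j) (\<lambda>x. x \<bullet> c j)" for j
  have weak: "weakly (momentum1 B) = weakly (M True)" "weakly (momentum2 B) = weakly (M False)"
    by (simp_all add: fun_eq_iff weakly_momentum_iff M_def e_def c_def)
  define Q where "Q j x = - \<i> * (of_nat k * complex_coord (e j) * complex_coord x ^ (k - 1)) + gauss_symbol \<Omega> (e j) (c j) x * complex_coord x ^ k" for j x
  define R where "R j x = (gauss_symbol \<Omega> (e j) (c j) x ^ 2 + (- \<i> * gauss_symbol \<Omega> (e j) (c j) (e j))) * complex_coord x ^ k
             + (- 2 * \<i> * of_nat k * complex_coord (e j)) * gauss_symbol \<Omega> (e j) (c j) x * complex_coord x ^ (k - 1)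
             + (- of_nat k * of_nat (k - 1) * complex_coord (e j) ^ 2) * complex_coord x ^ (k - 1 - 1)" for j x
  have Q: "smooth (Q j)" "poly_growth (Q j)" and Mu: "M j ?u = (\<lambda>x. Q j x * gauss \<Omega> x)" for j
    unfolding Q_def[abs_def]
    by (intro smooth_intros, intro poly_growth_intros, simp add: M_def magnetic_orbital)
  have R: "poly_growth (R j)" and MMu: "M j (M j ?u) = (\<lambda>x. R j x * gauss \<Omega> x)" for j
    unfolding R_def[abs_def]
    by (intro poly_growth_intros, simp add: M_def magnetic_magnetic_orbital)
  have u: "smooth ?u" "?u \<in> L2"
    unfolding orbital_def[abs_def]
    by (intro smooth_intros smooth_gauss, intro gauss_L2 poly_growth_intros \<Omega>)
  have MuL2: "M j ?u \<in> L2" for j unfolding Mu by (intro gauss_L2 Q \<Omega>)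
  have weak_u: "weakly (M j) ?u (M j ?u)" for j
    unfolding weakly_def M_def by (intro ballI magnetic_symmetric u continuous_intros)
  have V: "V x = \<omega>\<^sup>2 * (norm x)\<^sup>2 - \<mu>" for x
    by (simp add: V_def norm_prod_sq algebra_simps)
  have VuL2: "(\<lambda>x. of_real (V x) * ?u x) \<in> L2"
  proof -
    have "(\<lambda>x. of_real (V x)) = (\<lambda>x. of_real (\<omega>\<^sup>2) * of_real (fst x) ^ 2
          + of_real (\<omega>\<^sup>2) * of_real (snd x) ^ 2 + complex_of_real (- \<mu>))"
      by (simp add: V_def)
    moreover have "poly_growth \<dots>"
      by (intro poly_growth_intros poly_growth_fst poly_growth_snd)
    ultimately have "poly_growth (\<lambda>x. of_real (V x) * complex_coord x ^ k)"
      by (intro poly_growth_intros) simp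
    from gauss_L2[OF this \<Omega>(1)] show ?thesis by (simp add: orbital_def mult.assoc)
  qed
  have dom: "?u \<in> form_domain B V"
  proof -
    have "integrable lborel (\<lambda>x. cmod (of_real (V x) * ?u x) * cmod (?u x))"
      by (intro L2_mult_integrable VuL2 u)
    hence "integrable lborel (\<lambda>x. \<bar>V x\<bar> * (cmod (?u x))\<^sup>2)"
      by (simp add: norm_mult power2_eq_square mult.assoc)
    thus ?thesis using u(2) MuL2 weak_u by (auto simp: form_domain_def weak)
  qed
  have EuL2: "(\<lambda>x. of_real E * ?u x) \<in> L2" by (intro L2_scale u)
  have eigen: "M True (M True ?u) x + M False (M False ?u) x + of_real (V x) * ?u x = of_real E * ?u x" for x
    using fock_darwin_eigenfunction[OF \<Omega>(2), of k x]
    by (simp add: M_def e_def c_def V E_def algebra_simps)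
  have "form_value B V ?u v (L2_inner (\<lambda>x. of_real E * ?u x) v)" if v: "v \<in> form_domain B V" for v
  proof -
    from v obtain q where q: "\<And>j. q j \<in> L2" "\<And>j. weakly (M j) v (q j)"
    proof -
      from v obtain q1 q2 where "q1 \<in> L2" "q2 \<in> L2" "weakly (M True) v q1" "weakly (M False) v q2"
        by (auto simp: form_domain_def weak)
      thus ?thesis using that[of "\<lambda>j. if j then q1 else q2"] by simp
    qed
    have vL2: "v \<in> L2" using v by (simp add: form_domain_def)
    have ibp: "L2_inner (M j ?u) (q j) = L2_inner (M j (M j ?u)) v" for j
      using gauss_integration_by_parts[OF \<Omega>(1) Q(1)[of j] Q(2)[of j] Mu[of j] R[of j], where e = "e j"
          and w = "\<lambda>x. x \<bullet> c j" and v = v and q = "q j", folded M_def] q vL2 MMu by simp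
    have "L2_inner (M True ?u) (q True) + L2_inner (M False ?u) (q False)
          + (LINT x|lborel. of_real (V x) * ?u x * cnj (v x))
        = (LINT x|lborel. M True (M True ?u) x * cnj (v x) + M False (M False ?u) x * cnj (v x)
             + of_real (V x) * ?u x * cnj (v x))"
    proof -
      have "M j (M j ?u) \<in> L2" for j unfolding MMu by (intro gauss_L2 R \<Omega>)
      hence "integrable lborel (\<lambda>x. M j (M j ?u) x * cnj (v x))" for j
        by (intro L2_mult_integrable vL2)
      moreover have "integrable lborel (\<lambda>x. of_real (V x) * ?u x * cnj (v x))"
        by (intro L2_mult_integrable vL2 VuL2)
      ultimately show ?thesis unfolding ibp unfolding L2_inner_def by simp
    qed
    also have "\<dots> = L2_inner (\<lambda>x. of_real E * ?u x) v"
      by (simp add: L2_inner_def eigen flip: distrib_right)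
    finally show ?thesis
      unfolding form_value_def weak
      by (intro conjI dom v bexI[of _ "M True ?u"] bexI[of _ "M False ?u"] bexI[of _ "q True"]
            bexI[of _ "q False"] MuL2 weak_u q) (rule sym)
  qed
  thus ?thesis using dom EuL2 by (simp add: landau_op_def)
qed

section \<open>Bounds on the two sides\<close>

lemma orbital_not_AE_zero: "\<not> (AE x in lborel. orbital \<Omega> k x = 0)"
proof
  assume "AE x in lborel. orbital \<Omega> k x = 0"
  moreover have "AE x :: real \<times> real in lborel. x \<noteq> 0"
    by (rule AE_lborel_singleton)
  ultimately have "AE x :: real \<times> real in lborel. False"
  proof eventually_elim
    case (elim x)
    hence "complex_coord x = 0" by (auto simp: orbital_def gauss_def)
    hence "x = 0" by (cases x) (simp add: complex_coord_def complex_eq_iff zero_prod_def)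
    thus False using elim by simp
  qed
  hence "emeasure lborel (space (lborel :: (real \<times> real) measure)) = 0"
    by (simp add: AE_iff_measurable[OF _ refl])
  thus False by simp
qed

text \<open>Only a lower bound on the multiplicities is used: each eigenvalue has at least the one eigenfunction
  that is given.\<close>

lemma trace_neg_ge_sum:
  assumes K: "finite K"
    and eig: "\<And>k. k \<in> K \<Longrightarrow> landau_op B V (u k) (\<lambda>x. of_real (E k) * u k x)"
    and nz: "\<And>k. k \<in> K \<Longrightarrow> \<not> (AE x in lborel. u k x = 0)"
    and inj: "inj_on E K" and neg: "\<And>k. k \<in> K \<Longrightarrow> E k < 0"
  shows "(\<Sum>k\<in>K. ennreal (\<bar>E k\<bar> powr \<gamma>)) \<le> trace_neg \<gamma> B V"
proof -
  have mem: "u k \<in> eigenspace B V (E k)" if "k \<in> K" for k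
    using eig[OF that] by (simp add: eigenspace_def)
  have mult: "multiplicity_of B V (E k) \<ge> 1" if k: "k \<in> K" for k
  proof -
    have "L2_independent {u k}"
      using nz[OF k] by (auto simp: L2_independent_def)
    hence "{u k} \<in> {S. finite S \<and> S \<subseteq> eigenspace B V (E k) \<and> L2_independent S}"
      using mem[OF k] by simp
    from SUP_upper[OF this, of "\<lambda>S. of_nat (card S)"] show ?thesis
      by (simp add: multiplicity_of_def)
  qed
  have "(\<Sum>k\<in>K. ennreal (\<bar>E k\<bar> powr \<gamma>)) = (\<Sum>x\<in>E ` K. ennreal (\<bar>x\<bar> powr \<gamma>))"
    by (simp add: sum.reindex[OF inj])
  also have "\<dots> \<le> (\<Sum>x\<in>E ` K. multiplicity_of B V x * ennreal (\<bar>x\<bar> powr \<gamma>))"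
  proof (rule sum_mono)
    fix x assume "x \<in> E ` K"
    hence "1 \<le> multiplicity_of B V x" using mult by blast
    from mult_right_mono[OF this, of "ennreal (\<bar>x\<bar> powr \<gamma>)"]
    show "ennreal (\<bar>x\<bar> powr \<gamma>) \<le> multiplicity_of B V x * ennreal (\<bar>x\<bar> powr \<gamma>)" by simp
  qed
  also have "\<dots> = (\<Sum>\<^sub>\<infinity>x\<in>E ` K. multiplicity_of B V x * ennreal (\<bar>x\<bar> powr \<gamma>))"
    using K by simp
  also have "\<dots> \<le> trace_neg \<gamma> B V"
    unfolding trace_neg_def
  proof (rule infsum_mono_neutral)
    fix x assume "x \<in> E ` K - {E \<in> eigenvalues B V. E < 0}"
    moreover have "E ` K \<subseteq> {E \<in> eigenvalues B V. E < 0}"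
      using mem nz neg by (auto simp: eigenvalues_def)
    ultimately show "multiplicity_of B V x * ennreal (\<bar>x\<bar> powr \<gamma>) \<le> 0" by blast
  qed (auto intro: nonneg_summable_on_complete)
  finally show ?thesis .
qed

text \<open>The levels \<open>m \<ge> 1\<close> start at \<open>3 B \<ge> \<mu>\<close>, so their integrands vanish.\<close>

lemma semiclassical_sum:
  assumes B: "B > 0" and \<omega>: "\<omega> \<noteq> 0" and \<gamma>: "\<gamma> \<ge> 0" and \<mu>: "B \<le> \<mu>" "\<mu> \<le> 3 * B"
  shows "ennreal (B / (2 * pi)) * (\<Sum>m. \<integral>\<^sup>+ x. ennreal (neg_powr \<gamma> ((2 * real m + 1) * B +
       (\<omega>\<^sup>2 * (fst x)\<^sup>2 + \<omega>\<^sup>2 * (snd x)\<^sup>2 - \<mu>))) \<partial>(lborel :: (real \<times> real) measure))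
     = ennreal (B / (2 * \<omega>\<^sup>2) * ((\<mu> - B) powr (\<gamma> + 1) / (\<gamma> + 1)))"
proof -
  let ?I = "\<lambda>m. \<integral>\<^sup>+ x. ennreal (neg_powr \<gamma> ((2 * real m + 1) * B +
       (\<omega>\<^sup>2 * (fst x)\<^sup>2 + \<omega>\<^sup>2 * (snd x)\<^sup>2 - \<mu>))) \<partial>(lborel :: (real \<times> real) measure)"
  have "?I m = 0" if "m \<noteq> 0" for m
  proof -
    have "3 * B \<le> (2 * real m + 1) * B" using that B by (intro mult_right_mono) auto
    hence "neg_powr \<gamma> ((2 * real m + 1) * B + (\<omega>\<^sup>2 * (fst x)\<^sup>2 + \<omega>\<^sup>2 * (snd x)\<^sup>2 - \<mu>)) = 0"
      for x :: "real \<times> real"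
    proof -
      have "0 \<le> \<omega>\<^sup>2 * (fst x)\<^sup>2 + \<omega>\<^sup>2 * (snd x)\<^sup>2" by simp
      hence "0 \<le> (2 * real m + 1) * B + (\<omega>\<^sup>2 * (fst x)\<^sup>2 + \<omega>\<^sup>2 * (snd x)\<^sup>2 - \<mu>)"
        using \<open>3 * B \<le> _\<close> \<mu> by linarith
      thus ?thesis by (simp add: neg_powr_def max_def)
    qed
    thus ?thesis by simp
  qed
  hence "(\<Sum>m. ?I m) = (\<Sum>m\<in>{0}. ?I m)"
    by (intro suminf_finite) auto
  also have "\<dots> = (\<integral>\<^sup>+ x. ennreal (neg_powr \<gamma> (\<omega>\<^sup>2 * (norm x)\<^sup>2 - (\<mu> - B))) \<partial>(lborel :: (real \<times> real) measure))"
    by (simp add: norm_prod_sq algebra_simps)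
  also have "\<dots> = ennreal (pi / \<omega>\<^sup>2 * ((\<mu> - B) powr (\<gamma> + 1) / (\<gamma> + 1)))"
    using \<omega> \<gamma> \<mu> by (intro nn_integral_neg_powr_paraboloid) auto
  finally show ?thesis using B \<gamma> by (simp flip: ennreal_mult)
qed

section \<open>Power inequalities\<close>

lemma powr_one_plus_le:
  fixes y c :: real
  assumes "0 \<le> c" "c < 1" "- 1 < y"
  shows "(1 + y) powr c \<le> 1 + c * y"
  using Youngs_inequality_0[of c "1 - c" "1 + y" 1] assms by (simp add: algebra_simps)

text \<open>A concave function lies below its tangent at \<open>m\<close>.\<close>

lemma powr_tangent:
  fixes s m c :: real
  assumes "0 \<le> c" "c < 1" "0 < s" "0 < m"
  shows "s powr c \<le> m powr c * (1 + c * ((s - m) / m))"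
proof -
  have "s = m * (1 + (s - m) / m)" using assms by (simp add: field_simps)
  moreover have "0 < 1 + (s - m) / m" using assms by (simp add: field_simps)
  ultimately have "s powr c = m powr c * (1 + (s - m) / m) powr c"
    using assms by (metis powr_mult)
  also have "\<dots> \<le> m powr c * (1 + c * ((s - m) / m))"
    using powr_one_plus_le[OF assms(1,2), of "(s - m) / m"] \<open>0 < 1 + (s - m) / m\<close>
    by (intro mult_left_mono) auto
  finally show ?thesis .
qed

text \<open>Integrating the tangent line at \<open>j + 1 / 2\<close> over \<open>{j..j + 1}\<close> gives the value at the midpoint, since the
  linear part cancels. The proof avoids integrals: \<open>G\<close> below is a primitive of tangent minus function,
  up to a positive factor, hence increasing.\<close>

lemma powr_midpoint:
  fixes c :: real
  assumes c: "0 \<le> c" "c < 1"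
  shows "((real j + 1) powr (c + 1) - real j powr (c + 1)) / (c + 1) \<le> (real j + 1 / 2) powr c"
proof -
  define m where "m = real j + 1 / 2"
  have m: "m > 0" by (simp add: m_def)
  define G where "G s = (c + 1) * (m powr c * (s + c * ((s - m)\<^sup>2 / (2 * m)))) - s powr (c + 1)" for s
  have "G (real j) \<le> G (real j + 1)"
  proof (rule DERIV_nonneg_imp_increasing_open[where f = G])
    show "continuous_on {real j..real j + 1} G"
      unfolding G_def using c m by (intro continuous_intros continuous_on_powr') auto
    fix s assume s: "real j < s" "s < real j + 1"
    hence s0: "s > 0" by linarith
    have "(G has_real_derivative (c + 1) * (m powr c * (1 + c * ((s - m) / m)) - s powr c)) (at s)"
      unfolding G_def using m s0
      by (auto intro!: derivative_eq_intros simp: field_simps)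
    moreover have "(c + 1) * (m powr c * (1 + c * ((s - m) / m)) - s powr c) \<ge> 0"
      using powr_tangent[OF c s0 m] c by simp
    ultimately show "\<exists>y. (G has_real_derivative y) (at s) \<and> 0 \<le> y" by blast
  qed simp
  moreover have "(real j + 1 - m)\<^sup>2 = (real j - m)\<^sup>2" by (simp add: m_def power2_eq_square)
  hence "G (real j + 1) - G (real j)
      = (c + 1) * m powr c - ((real j + 1) powr (c + 1) - real j powr (c + 1))"
    by (simp add: G_def algebra_simps)
  ultimately show ?thesis using c by (simp add: m_def field_simps)
qed

lemma powr_le_midpoint_sum:
  fixes c :: real
  assumes c: "0 \<le> c" "c < 1"
  shows "real p powr (c + 1) / (c + 1) \<le> (\<Sum>j<p. (real j + 1 / 2) powr c)"
proof -
  have "real p powr (c + 1) / (c + 1)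
      = (\<Sum>j<p. (real (Suc j) powr (c + 1) - real j powr (c + 1)) / (c + 1))"
    using c sum_lessThan_telescope[of "\<lambda>j. real j powr (c + 1)" p]
    by (simp del: of_nat_Suc flip: sum_divide_distrib)
  also have "\<dots> \<le> (\<Sum>j<p. (real j + 1 / 2) powr c)"
    using powr_midpoint[OF c] by (intro sum_mono) (simp add: add.commute)
  finally show ?thesis .
qed

text \<open>With \<open>x = 1 / (2 p)\<close> the claim is \<open>(1 + x)\<^bsup>c + 2\<^esup> < 1 + 3 x\<close>. Bounding \<open>(1 + x)\<^sup>c\<close> by \<open>1 + c x\<close> leaves a
  polynomial inequality whose leading term is \<open>(1 - c) x > 0\<close>.\<close>

lemma semiclassical_term_less:
  fixes c :: real and p :: nat
  assumes c: "0 \<le> c" "c < 1" and p: "real p > 2 / (1 - c)"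
  shows "(real p + 1 / 2) powr (c + 2) / (real p + 3 / 2) < real p powr (c + 1)"
proof -
  define x where "x = 1 / (2 * real p)"
  have p2: "(1 - c) * real p > 2" using p c by (simp add: field_simps)
  have p0: "real p > 0" using p c by (smt (verit) divide_pos_pos)
  have x: "0 < x" "4 * x < 1 - c" using p0 p2 by (simp_all add: x_def field_simps)
  have e: "real p + 1 / 2 = real p * (1 + x)" "real p + 3 / 2 = real p * (1 + 3 * x)"
    using p0 by (simp_all add: x_def field_simps)
  have "(1 + x) powr (c + 2) = (1 + x)\<^sup>2 * (1 + x) powr c"
    using x by (simp add: powr_add powr_numeral)
  also have "\<dots> \<le> (1 + x)\<^sup>2 * (1 + c * x)"
    using powr_one_plus_le[OF c, of x] x by (intro mult_left_mono) auto
  also have "\<dots> < 1 + 3 * x"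
  proof -
    have "c * x \<le> x" "c * x * x \<le> x"
    proof -
      show "c * x \<le> x" using c x by (simp add: mult_left_le_one_le)
      moreover have "x \<le> 1" using x c by linarith
      ultimately show "c * x * x \<le> x" using c x
        by (smt (verit) mult_left_le mult_nonneg_nonneg)
    qed
    hence "x + 2 * (c * x) + c * x * x < 1 - c" using x by linarith
    hence "x * (x + 2 * (c * x) + c * x * x) < x * (1 - c)" using x by (intro mult_strict_left_mono)
    moreover have "(1 + x)\<^sup>2 * (1 + c * x) = 1 + 2 * x + c * x + x * (x + 2 * (c * x) + c * x * x)"
      by algebra
    ultimately show ?thesis by (simp add: algebra_simps)
  qed
  finally have "(1 + x) powr (c + 2) < 1 + 3 * x" .
  hence "real p powr (c + 2) * (1 + x) powr (c + 2) < real p powr (c + 2) * (1 + 3 * x)"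
    using p0 by (intro mult_strict_left_mono) auto
  moreover have "real p powr (c + 2) = real p powr (c + 1) * real p"
    using powr_add[of "real p" "c + 1" 1] p0 by (simp add: algebra_simps)
  moreover have "(real p * (1 + x)) powr (c + 2) = real p powr (c + 2) * (1 + x) powr (c + 2)"
    using p0 x by (simp add: powr_mult)
  ultimately have "(real p * (1 + x)) powr (c + 2) < real p powr (c + 1) * (real p * (1 + 3 * x))"
    by (simp add: mult.assoc)
  moreover have "0 < real p * (1 + 3 * x)" using p0 x by simp
  ultimately show ?thesis unfolding e by (subst pos_divide_less_eq)
qed

section \<open>Failure of the semiclassical bound\<close>

theorem proposition3:
  fixes \<gamma> :: real
  assumes "0 \<le> \<gamma>" and "\<gamma> < 1"
  shows "\<exists>B \<mu> \<omega>1 \<omega>2 :: real. B > 0 \<and> \<mu> > 0 \<and> \<omega>1 = \<omega>2 \<and> \<omega>2 > 0 \<and>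
    (let V = (\<lambda>x :: real \<times> real. \<omega>1\<^sup>2 * (fst x)\<^sup>2 + \<omega>2\<^sup>2 * (snd x)\<^sup>2 - \<mu>) in
      trace_neg \<gamma> B V >
        ennreal (B / (2 * pi)) *
        (\<Sum>m. \<integral>\<^sup>+ x. ennreal (neg_powr \<gamma> ((2 * real m + 1) * B + V x)) \<partial>lborel))"
proof -
  obtain p :: nat where p: "real p > 2 / (1 - \<gamma>)" using reals_Archimedean2 by blast
  \<comment> \<open>Here \<open>2 * \<Omega> - B\<close>, the distance of consecutive eigenvalues, is \<open>1\<close>, and \<open>2 * \<Omega> + B = p + 3 / 2\<close>;
      the relation between \<open>B\<close>, \<open>\<omega>\<close> and \<open>\<Omega>\<close> forces \<open>4 * \<omega>\<^sup>2\<close> to be their product.\<close>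
  define B where "B = (real p + 1 / 2) / 2"
  define \<Omega> where "\<Omega> = (real p + 5 / 2) / 4"
  define \<omega> where "\<omega> = sqrt (real p + 3 / 2) / 2"
  define V where "V x = \<omega>\<^sup>2 * (fst x)\<^sup>2 + \<omega>\<^sup>2 * (snd x)\<^sup>2 - 3 * B" for x :: "real \<times> real"
  define E where "E k = real k + 1 / 2 - real p" for k
  have pos: "B > 0" "\<Omega> > 0" "\<omega> > 0" by (simp_all add: B_def \<Omega>_def \<omega>_def add_pos_nonneg add_nonneg_pos)
  have \<omega>2: "\<omega>\<^sup>2 = (real p + 3 / 2) / 4" by (simp add: \<omega>_def power_divide)
  have \<Omega>2: "\<Omega>\<^sup>2 = B\<^sup>2 / 4 + \<omega>\<^sup>2" unfolding \<omega>2 B_def \<Omega>_def by (simp add: power2_eq_square field_simps)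
  have "landau_op B V (orbital \<Omega> k) (\<lambda>x. of_real (E k) * orbital \<Omega> k x)" for k
  proof -
    have "2 * \<Omega> + real k * (2 * \<Omega> - B) - 3 * B = E k"
      by (simp add: \<Omega>_def B_def E_def field_simps)
    thus ?thesis using landau_op_orbital[OF pos(2) \<Omega>2, of "3 * B" k] by (simp add: V_def[abs_def])
  qed
  hence "(\<Sum>k<p. ennreal (\<bar>E k\<bar> powr \<gamma>)) \<le> trace_neg \<gamma> B V"
    by (intro trace_neg_ge_sum[where u = "orbital \<Omega>"] orbital_not_AE_zero)
       (auto simp: E_def inj_on_def)
  moreover have "(\<Sum>k<p. ennreal (\<bar>E k\<bar> powr \<gamma>)) = ennreal (\<Sum>j<p. (real j + 1 / 2) powr \<gamma>)"
  proof -
    have "(\<Sum>k<p. \<bar>E k\<bar> powr \<gamma>) = (\<Sum>k<p. \<bar>E (p - Suc k)\<bar> powr \<gamma>)"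
      by (rule sum.nat_diff_reindex[symmetric])
    also have "\<dots> = (\<Sum>j<p. (real j + 1 / 2) powr \<gamma>)"
      by (intro sum.cong) (auto simp: E_def of_nat_diff add.commute)
    finally show ?thesis by (simp add: sum_ennreal)
  qed
  moreover have "B / (2 * \<omega>\<^sup>2) * ((3 * B - B) powr (\<gamma> + 1) / (\<gamma> + 1)) < (\<Sum>j<p. (real j + 1 / 2) powr \<gamma>)"
  proof -
    have "B / (2 * \<omega>\<^sup>2) * ((3 * B - B) powr (\<gamma> + 1) / (\<gamma> + 1))
        = (real p + 1 / 2) powr (\<gamma> + 2) / (real p + 3 / 2) / (\<gamma> + 1)"
    proof -
      have "(real p + 1 / 2) powr (\<gamma> + 2) = (real p + 1 / 2) * (real p + 1 / 2) powr (\<gamma> + 1)"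
        using powr_add[of "real p + 1 / 2" 1 "\<gamma> + 1"] by (simp add: add_nonneg_pos algebra_simps)
      moreover have "B / (2 * \<omega>\<^sup>2) = (real p + 1 / 2) / (real p + 3 / 2)" "3 * B - B = real p + 1 / 2"
        unfolding \<omega>2 B_def by (simp_all add: field_simps)
      ultimately show ?thesis by simp
    qed
    also have "\<dots> < real p powr (\<gamma> + 1) / (\<gamma> + 1)"
      using semiclassical_term_less[OF assms p] assms by (intro divide_strict_right_mono) auto
    also have "\<dots> \<le> (\<Sum>j<p. (real j + 1 / 2) powr \<gamma>)"
      by (rule powr_le_midpoint_sum[OF assms])
    finally show ?thesis .
  qed
  ultimately have "ennreal (B / (2 * pi)) *
        (\<Sum>m. \<integral>\<^sup>+ x. ennreal (neg_powr \<gamma> ((2 * real m + 1) * B + V x)) \<partial>lborel) < trace_neg \<gamma> B V"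
    using pos assms unfolding V_def
    by (subst semiclassical_sum) (auto simp: ennreal_less_iff elim!: less_le_trans[rotated])
  thus ?thesis
    using pos by (intro exI[of _ B] exI[of _ "3 * B"] exI[of _ \<omega>]) (simp add: V_def[abs_def])
qed

end
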